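(* Let $X$ be a $K3$ surface equipped with a polarization $\mathcal{O}_X(1)$, and let $TX$ be its tangent bundle. Let $V$ be a non-split extension $$0\rightarrow TX\rightarrow V\rightarrow \mathcal{O}_X\rightarrow 0,$$ and equip the rank $6$ vector bundle $V\oplus V^{\vee}$ with the symplectic structure (skew-symmetric nondegenerate form) $\omega:(V\oplus V^{\vee})\otimes(V\oplus V^{\vee})\to\mathcal{O}_X$, $\omega((v,f),(w,g))=g(v)-f(w)$, given by the duality pairing. Let $E$ be the corresponding principal $\mathrm{Sp}(6,\mathbb{C})$-bundle over $X$. Then the Gieseker Harder-Narasimhan filtration $$0\subset \mathcal{O}_X\subset V\oplus\mathcal{O}_X\subset V\oplus V^{\vee}$$ of $V\oplus V^{\vee}$ (where $\mathcal{O}_X\subset V^{\vee}$ is the dual of the surjection $V\to\mathcal{O}_X$) does not correspond to any parabolic reduction of the principal $\mathrm{Sp}(6,\mathbb{C})$-bundle $E$.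
   Context: A $K3$ surface is a smooth complex projective surface $X$ with $h^1(\mathcal{O}_X)=0$ and trivial canonical bundle. A polarization is an ample line bundle $\mathcal{O}_X(1)$ on $X$. The Hilbert polynomial of a torsion free coherent sheaf $F$ on $X$ is $P_F(m)=\chi(F\otimes\mathcal{O}_X(m))$. Polynomials in $m$ are compared by their values for $m\gg 0$. A torsion free coherent sheaf $F$ is Gieseker semistable if for every nonzero subsheaf $F'\subset F$ with $\operatorname{rk}F'<\operatorname{rk}F$ one has $\frac{P_{F'}(m)}{\operatorname{rk}F'}\leq\frac{P_F(m)}{\operatorname{rk}F}$ for $m\gg 0$. The Gieseker Harder-Narasimhan filtration of a torsion free sheaf $F$ is the unique filtration $0\subset F_1\subset\cdots\subset F_{t+1}=F$ whose successive quotients $F^i=F_i/F_{i-1}$ (with $F_0=0$) are torsion free and Gieseker semistable and satisfy $\frac{P_{F^1}(m)}{\operatorname{rk}F^1}>\cdots>\frac{P_{F^{t+1}}(m)}{\operatorname{rk}F^{t+1}}$ for $m\gg0$. For $V\oplus V^\vee$ as in the claim, this filtration is the one displayed there. Filtration corresponding to a parabolic reduction. Let $G=\mathrm{Sp}(6,\mathbb{C})$ with its standard representation on $\mathbb{C}^6$, and let $E$ be a principal $G$-bundle on $X$ with associated vector bundle $E(\mathbb{C}^6)$ (here $E(\mathbb{C}^6)=V\oplus V^{\vee}$). A one parameter subgroup $\lambda:\mathbb{C}^*\to G$ defines the parabolic subgroup $P(\lambda)=\{g\in G\mid \lim_{t\to\infty}\lambda(t)g\lambda(t)^{-1}\text{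 exists in }G\}$; all parabolic subgroups are of this form. Let $\gamma_1<\cdots<\gamma_l$ be the distinct weights of $\lambda$ on $\mathbb{C}^6$, let $W^i$ be the subspace on which $\lambda(t)$ acts as $t^{\gamma_i}$, and set $W_i=\bigoplus_{j=1}^i W^j$. The filtration $0\subset W_1\subset\cdots\subset W_l=\mathbb{C}^6$ is preserved by $P(\lambda)$. An open subset $\iota:U\hookrightarrow X$ is big if its complement has codimension at least $2$. A reduction of structure group of $E$ to $P(\lambda)$ over a big open set $U$ produces, by associating the $P(\lambda)$-subrepresentations $W_i$, a filtration of $E(\mathbb{C}^6)|_U$ by subbundles $F_1^U\subset\cdots\subset F_l^U=E(\mathbb{C}^6)|_U$, and hence a filtration $0\subset F_1\subset\cdots\subset F_l=E(\mathbb{C}^6)$ by the torsion free sheaves $F_i=\iota_*F_i^U\cap E(\mathbb{C}^6)$. A filtration of $E(\mathbb{C}^6)$ corresponds to a parabolic reduction of $E$ if it equals the filtration $F_\bullet$ obtained in this way from some $\lambda$, some big open set $U$ and some reduction of structure group of $E$ to $P(\lambda)$ over $U$. *)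

theory Defs
  imports
    "HOL-Analysis.Analysis"
    "HOL-Algebra.Module"
    "HOL-Computational_Algebra.Polynomial"
    "HOL-Library.Extended_Nat"
begin

section \<open>Complex projective varieties\<close>

text \<open>A point of the projective space of \<open>\<complex>\<^sup>n\<close> is a line through the origin. Since the index type
  is arbitrary, every projective space occurs. Polynomials are represented by their functions
  (the base field is infinite).\<close>

type_synonym 'n pt = "(complex ^ 'n) set"

definition homogeneous :: "nat \<Rightarrow> (complex ^ 'n::finite \<Rightarrow> complex) \<Rightarrow> bool" where
  "homogeneous d P \<longleftrightarrow>
     (\<exists>c :: ('n \<Rightarrow> nat) \<Rightarrow> complex. \<forall>v.
        P v = (\<Sum>m \<in> {m. (\<Sum>i\<in>UNIV. m i) = d}. c m * (\<Prod>i\<in>UNIV. (v $ i) ^ m i)))"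

definition proj_space :: "'n::finite pt set" where
  "proj_space = {range (\<lambda>c. c *s v) | v. v \<noteq> 0}"

definition zariski_space :: "'n::finite pt topology" where
  "zariski_space =
     topology_generated_by {{x \<in> proj_space. \<exists>v\<in>x. P v \<noteq> 0} | P. \<exists>d. homogeneous d P}"

abbreviation zariski :: "'n::finite pt set \<Rightarrow> 'n pt topology" where
  "zariski X \<equiv> subtopology zariski_space X"

definition Op :: "'n::finite pt set \<Rightarrow> 'n pt set \<Rightarrow> 'n pt set set" where
  "Op X U = {W. openin (zariski X) W \<and> W \<subseteq> U}"

definition regular_fun :: "'n::finite pt set \<Rightarrow> 'n pt set \<Rightarrow> ('n pt \<Rightarrow> complex) \<Rightarrow> bool" where
  "regular_fun X U f \<longleftrightarrow> f \<in> extensional U \<and>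
     (\<forall>x\<in>U. \<exists>W\<in>Op X U. x \<in> W \<and>
        (\<exists>d P Q. homogeneous d P \<and> homogeneous d Q \<and>
           (\<forall>y\<in>W. \<forall>v\<in>y - {0}. Q v \<noteq> 0 \<and> f y = P v / Q v)))"

definition reg_ring :: "'n::finite pt set \<Rightarrow> 'n pt set \<Rightarrow> ('n pt \<Rightarrow> complex) ring" where
  "reg_ring X U =
     \<lparr>carrier = {f. regular_fun X U f},
      mult = (\<lambda>f g. \<lambda>x\<in>U. f x * g x), one = (\<lambda>x\<in>U. 1),
      zero = (\<lambda>x\<in>U. 0), add = (\<lambda>f g. \<lambda>x\<in>U. f x + g x)\<rparr>"

abbreviation \<O> :: "'n::finite pt set \<Rightarrow> 'n pt set \<Rightarrow> ('n pt \<Rightarrow> complex) set" where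
  "\<O> X U \<equiv> carrier (reg_ring X U)"


subsection \<open>Dimension and codimension\<close>

definition irreducible_closed :: "'a topology \<Rightarrow> 'a set \<Rightarrow> bool" where
  "irreducible_closed T Z \<longleftrightarrow> closedin T Z \<and> Z \<noteq> {} \<and>
     (\<forall>A B. closedin T A \<and> closedin T B \<and> Z \<subseteq> A \<union> B \<longrightarrow> Z \<subseteq> A \<or> Z \<subseteq> B)"

definition irreducible_chain :: "'a topology \<Rightarrow> nat \<Rightarrow> (nat \<Rightarrow> 'a set) \<Rightarrow> bool" where
  "irreducible_chain T k c \<longleftrightarrow>
     (\<forall>i\<le>k. irreducible_closed T (c i)) \<and> (\<forall>i<k. c i \<subset> c (Suc i))"

definition krull_dim :: "'a topology \<Rightarrow> enat" where
  "krull_dim T = Sup {enat k | k. \<exists>c. irreducible_chain T k c}"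

definition codim :: "'a topology \<Rightarrow> 'a set \<Rightarrow> enat" where
  "codim T A =
     Inf {Sup {enat k | k. \<exists>c. irreducible_chain T k c \<and> c 0 = Z} | Z.
            irreducible_closed T Z \<and> Z \<subseteq> A}"

definition big_open :: "'n::finite pt set \<Rightarrow> 'n pt set \<Rightarrow> bool" where
  "big_open X U \<longleftrightarrow> openin (zariski X) U \<and> codim (zariski X) (X - U) \<ge> 2"


section \<open>Sheaves of modules\<close>

text \<open>The restriction from \<open>U\<close> to \<open>W\<close> is \<open>rest F U W\<close>. The multiplicative part of the ring record
  underlying a \<^typ>\<open>('a, 'b) module\<close> is irrelevant and left undefined.\<close>

record ('p, 'm) omodule =
  sect :: "'p set \<Rightarrow> ('p \<Rightarrow> complex, 'm) module"
  rest :: "'p set \<Rightarrow> 'p set \<Rightarrow> 'm \<Rightarrow> 'm"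

definition mk_module ::
    "'m set \<Rightarrow> 'm \<Rightarrow> ('m \<Rightarrow> 'm \<Rightarrow> 'm) \<Rightarrow> ('r \<Rightarrow> 'm \<Rightarrow> 'm) \<Rightarrow> ('r, 'm) module" where
  "mk_module C z a s =
     \<lparr>carrier = C, mult = undefined, one = undefined, zero = z, add = a, smult = s\<rparr>"

abbreviation Sec :: "('p, 'm) omodule \<Rightarrow> 'p set \<Rightarrow> 'm set" where
  "Sec F U \<equiv> carrier (sect F U)"

definition sheaf_of_modules :: "'n::finite pt set \<Rightarrow> ('n pt, 'm) omodule \<Rightarrow> bool" where
  "sheaf_of_modules X F \<longleftrightarrow>
     (\<forall>U\<in>Op X X. Module.module (reg_ring X U) (sect F U)) \<and>
     (\<forall>U\<in>Op X X. \<forall>W\<in>Op X U.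
        rest F U W \<in> Sec F U \<rightarrow> Sec F W \<and>
        (\<forall>s\<in>Sec F U. \<forall>t\<in>Sec F U.
           rest F U W (s \<oplus>\<^bsub>sect F U\<^esub> t) = rest F U W s \<oplus>\<^bsub>sect F W\<^esub> rest F U W t) \<and>
        (\<forall>f\<in>\<O> X U. \<forall>s\<in>Sec F U.
           rest F U W (f \<odot>\<^bsub>sect F U\<^esub> s) = restrict f W \<odot>\<^bsub>sect F W\<^esub> rest F U W s)) \<and>
     (\<forall>U\<in>Op X X. \<forall>s\<in>Sec F U. rest F U U s = s) \<and>
     (\<forall>U\<in>Op X X. \<forall>W\<in>Op X U. \<forall>W'\<in>Op X W. \<forall>s\<in>Sec F U.
        rest F W W' (rest F U W s) = rest F U W' s) \<and>
     (\<forall>\<U>\<subseteq>Op X X. \<forall>s\<in>Sec F (\<Union>\<U>). \<forall>t\<in>Sec F (\<Union>\<U>).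
        (\<forall>W\<in>\<U>. rest F (\<Union>\<U>) W s = rest F (\<Union>\<U>) W t) \<longrightarrow> s = t) \<and>
     (\<forall>\<U>\<subseteq>Op X X. \<forall>\<sigma>. (\<forall>W\<in>\<U>. \<sigma> W \<in> Sec F W) \<and>
        (\<forall>W\<in>\<U>. \<forall>W'\<in>\<U>. rest F W (W \<inter> W') (\<sigma> W) = rest F W' (W \<inter> W') (\<sigma> W')) \<longrightarrow>
        (\<exists>s\<in>Sec F (\<Union>\<U>). \<forall>W\<in>\<U>. rest F (\<Union>\<U>) W s = \<sigma> W))"

definition structure_sheaf :: "'n::finite pt set \<Rightarrow> ('n pt, 'n pt \<Rightarrow> complex) omodule" where
  "structure_sheaf X =
     \<lparr>sect = (\<lambda>U. mk_module (\<O> X U) (\<zero>\<^bsub>reg_ring X U\<^esub>)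
                  (\<lambda>f g. f \<oplus>\<^bsub>reg_ring X U\<^esub> g) (\<lambda>f g. f \<otimes>\<^bsub>reg_ring X U\<^esub> g)),
      rest = (\<lambda>U W f. restrict f W)\<rparr>"


subsection \<open>Sheaves whose sections are families of maps\<close>

text \<open>A section over \<open>U\<close> is a family of maps \<open>\<phi> W : D W \<rightarrow> F(W)\<close>, one for each open \<open>W \<subseteq> U\<close>,
  commuting with restriction. This covers sheaf Hom, derivations and multilinear forms.\<close>

definition nat_families ::
    "'n::finite pt set \<Rightarrow> ('n pt set \<Rightarrow> 'a set) \<Rightarrow> ('n pt set \<Rightarrow> 'n pt set \<Rightarrow> 'a \<Rightarrow> 'a) \<Rightarrow>
     ('n pt, 'm) omodule \<Rightarrow> 'n pt set \<Rightarrow> ('n pt set \<Rightarrow> 'a \<Rightarrow> 'm) set" where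
  "nat_families X D r F U =
     {\<phi> \<in> (\<Pi>\<^sub>E W\<in>Op X U. D W \<rightarrow>\<^sub>E Sec F W).
        \<forall>W\<in>Op X U. \<forall>W'\<in>Op X W. \<forall>a\<in>D W. \<phi> W' (r W W' a) = rest F W W' (\<phi> W a)}"

definition map_sheaf ::
    "'n::finite pt set \<Rightarrow> ('n pt set \<Rightarrow> 'a set) \<Rightarrow> ('n pt, 'm) omodule \<Rightarrow>
     ('n pt set \<Rightarrow> ('n pt set \<Rightarrow> 'a \<Rightarrow> 'm) set) \<Rightarrow> ('n pt, 'n pt set \<Rightarrow> 'a \<Rightarrow> 'm) omodule" where
  "map_sheaf X D F C =
     \<lparr>sect = (\<lambda>U. mk_module (C U)
         (\<lambda>W\<in>Op X U. \<lambda>a\<in>D W. \<zero>\<^bsub>sect F W\<^esub>)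
         (\<lambda>\<phi> \<psi>. \<lambda>W\<in>Op X U. \<lambda>a\<in>D W. \<phi> W a \<oplus>\<^bsub>sect F W\<^esub> \<psi> W a)
         (\<lambda>f \<phi>. \<lambda>W\<in>Op X U. \<lambda>a\<in>D W. restrict f W \<odot>\<^bsub>sect F W\<^esub> \<phi> W a)),
      rest = (\<lambda>U W \<phi>. restrict \<phi> (Op X W))\<rparr>"

definition sheaf_homs ::
    "'n::finite pt set \<Rightarrow> ('n pt, 'a) omodule \<Rightarrow> ('n pt, 'm) omodule \<Rightarrow> 'n pt set \<Rightarrow>
     ('n pt set \<Rightarrow> 'a \<Rightarrow> 'm) set" where
  "sheaf_homs X A F U =
     {\<phi> \<in> nat_families X (Sec A) (rest A) F U. \<forall>W\<in>Op X U.
        (\<forall>a\<in>Sec A W. \<forall>b\<in>Sec A W. \<phi> W (a \<oplus>\<^bsub>sect A W\<^esub> b) = \<phi> W a \<oplus>\<^bsub>sect F W\<^esub> \<phi> W b) \<and>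
        (\<forall>f\<in>\<O> X W. \<forall>a\<in>Sec A W. \<phi> W (f \<odot>\<^bsub>sect A W\<^esub> a) = f \<odot>\<^bsub>sect F W\<^esub> \<phi> W a)}"

definition hom_sheaf ::
    "'n::finite pt set \<Rightarrow> ('n pt, 'a) omodule \<Rightarrow> ('n pt, 'm) omodule \<Rightarrow>
     ('n pt, 'n pt set \<Rightarrow> 'a \<Rightarrow> 'm) omodule" where
  "hom_sheaf X A F = map_sheaf X (Sec A) F (sheaf_homs X A F)"

abbreviation dual_sheaf ::
    "'n::finite pt set \<Rightarrow> ('n pt, 'a) omodule \<Rightarrow>
     ('n pt, 'n pt set \<Rightarrow> 'a \<Rightarrow> 'n pt \<Rightarrow> complex) omodule" where
  "dual_sheaf X A \<equiv> hom_sheaf X A (structure_sheaf X)"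

definition derivations ::
    "'n::finite pt set \<Rightarrow> 'n pt set \<Rightarrow>
     ('n pt set \<Rightarrow> ('n pt \<Rightarrow> complex) \<Rightarrow> 'n pt \<Rightarrow> complex) set" where
  "derivations X U =
     {\<delta> \<in> nat_families X (\<O> X) (\<lambda>W W' f. restrict f W') (structure_sheaf X) U. \<forall>W\<in>Op X U.
        (\<forall>c. \<delta> W (\<lambda>x\<in>W. c) = \<zero>\<^bsub>reg_ring X W\<^esub>) \<and>
        (\<forall>f\<in>\<O> X W. \<forall>g\<in>\<O> X W.
           \<delta> W (f \<oplus>\<^bsub>reg_ring X W\<^esub> g) = \<delta> W f \<oplus>\<^bsub>reg_ring X W\<^esub> \<delta> W g \<and>
           \<delta> W (f \<otimes>\<^bsub>reg_ring X W\<^esub> g) =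
             f \<otimes>\<^bsub>reg_ring X W\<^esub> \<delta> W g \<oplus>\<^bsub>reg_ring X W\<^esub> g \<otimes>\<^bsub>reg_ring X W\<^esub> \<delta> W f)}"

definition tangent_sheaf ::
    "'n::finite pt set \<Rightarrow>
     ('n pt, 'n pt set \<Rightarrow> ('n pt \<Rightarrow> complex) \<Rightarrow> 'n pt \<Rightarrow> complex) omodule" where
  "tangent_sheaf X = map_sheaf X (\<O> X) (structure_sheaf X) (derivations X)"

definition tuples :: "nat \<Rightarrow> ('p, 'a) omodule \<Rightarrow> 'p set \<Rightarrow> 'a list set" where
  "tuples k A W = {as. length as = k \<and> set as \<subseteq> Sec A W}"

definition multilinear_maps ::
    "'n::finite pt set \<Rightarrow> nat \<Rightarrow> ('n pt, 'a) omodule \<Rightarrow> ('n pt, 'm) omodule \<Rightarrow> 'n pt set \<Rightarrow>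
     ('n pt set \<Rightarrow> 'a list \<Rightarrow> 'm) set" where
  "multilinear_maps X k A F U =
     {\<phi> \<in> nat_families X (tuples k A) (\<lambda>W W'. map (rest A W W')) F U. \<forall>W\<in>Op X U.
        \<forall>as\<in>tuples k A W. \<forall>i<k.
          (\<forall>a\<in>Sec A W. \<forall>b\<in>Sec A W.
             \<phi> W (as[i := a \<oplus>\<^bsub>sect A W\<^esub> b]) = \<phi> W (as[i := a]) \<oplus>\<^bsub>sect F W\<^esub> \<phi> W (as[i := b])) \<and>
          (\<forall>f\<in>\<O> X W. \<forall>a\<in>Sec A W.
             \<phi> W (as[i := f \<odot>\<^bsub>sect A W\<^esub> a]) = f \<odot>\<^bsub>sect F W\<^esub> \<phi> W (as[i := a]))}"

text \<open>On a smooth surface the canonical bundle is the sheaf of regular 2-forms, i.e. of alternating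
  bilinear forms on the tangent sheaf.\<close>

definition canonical_sheaf ::
    "'n::finite pt set \<Rightarrow>
     ('n pt, 'n pt set \<Rightarrow> ('n pt set \<Rightarrow> ('n pt \<Rightarrow> complex) \<Rightarrow> 'n pt \<Rightarrow> complex) list \<Rightarrow>
        'n pt \<Rightarrow> complex) omodule" where
  "canonical_sheaf X =
     map_sheaf X (tuples 2 (tangent_sheaf X)) (structure_sheaf X)
       (\<lambda>U. {\<phi> \<in> multilinear_maps X 2 (tangent_sheaf X) (structure_sheaf X) U.
              \<forall>W\<in>Op X U. \<forall>a\<in>Sec (tangent_sheaf X) W. \<phi> W [a, a] = \<zero>\<^bsub>reg_ring X W\<^esub>})"

text \<open>For a line bundle \<open>L\<close>, the twist \<open>F \<otimes> L\<^sup>m\<close> with \<open>m \<ge> 0\<close> is canonically the sheaf of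
  \<open>m\<close>-multilinear maps from the dual of \<open>L\<close> to \<open>F\<close>.\<close>

definition twist ::
    "'n::finite pt set \<Rightarrow> ('n pt, 'l) omodule \<Rightarrow> ('n pt, 'm) omodule \<Rightarrow> nat \<Rightarrow>
     ('n pt, 'n pt set \<Rightarrow> ('n pt set \<Rightarrow> 'l \<Rightarrow> 'n pt \<Rightarrow> complex) list \<Rightarrow> 'm) omodule" where
  "twist X L F m =
     map_sheaf X (tuples m (dual_sheaf X L)) F (multilinear_maps X m (dual_sheaf X L) F)"


subsection \<open>Exactness, bases, coherence, subsheaves and quotients\<close>

definition isomorphic_sheaves ::
    "'n::finite pt set \<Rightarrow> ('n pt, 'a) omodule \<Rightarrow> ('n pt, 'm) omodule \<Rightarrow> bool" where
  "isomorphic_sheaves X A F \<longleftrightarrow>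
     (\<exists>\<phi>\<in>sheaf_homs X A F X. \<forall>U\<in>Op X X. bij_betw (\<phi> U) (Sec A U) (Sec F U))"

definition short_exact ::
    "'n::finite pt set \<Rightarrow> ('n pt, 'a) omodule \<Rightarrow> ('n pt, 'v) omodule \<Rightarrow> ('n pt, 'b) omodule \<Rightarrow>
     ('n pt set \<Rightarrow> 'a \<Rightarrow> 'v) \<Rightarrow> ('n pt set \<Rightarrow> 'v \<Rightarrow> 'b) \<Rightarrow> bool" where
  "short_exact X A V B j p \<longleftrightarrow>
     j \<in> sheaf_homs X A V X \<and> p \<in> sheaf_homs X V B X \<and>
     (\<forall>U\<in>Op X X. inj_on (j U) (Sec A U) \<and>
        {v \<in> Sec V U. p U v = \<zero>\<^bsub>sect B U\<^esub>} = j U ` Sec A U \<and>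
        (\<forall>b\<in>Sec B U. \<forall>x\<in>U. \<exists>W\<in>Op X U. x \<in> W \<and> rest B U W b \<in> p W ` Sec V W))"

definition split_epi ::
    "'n::finite pt set \<Rightarrow> ('n pt, 'v) omodule \<Rightarrow> ('n pt, 'b) omodule \<Rightarrow>
     ('n pt set \<Rightarrow> 'v \<Rightarrow> 'b) \<Rightarrow> bool" where
  "split_epi X V B p \<longleftrightarrow>
     (\<exists>\<sigma>\<in>sheaf_homs X B V X. \<forall>U\<in>Op X X. \<forall>b\<in>Sec B U. p U (\<sigma> U b) = b)"

definition lin_comb ::
    "('p, 'm) omodule \<Rightarrow> 'p set \<Rightarrow> 'k set \<Rightarrow> ('k \<Rightarrow> 'p \<Rightarrow> complex) \<Rightarrow> ('k \<Rightarrow> 'm) \<Rightarrow> 'm" where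
  "lin_comb F U I f e = finsum (sect F U) (\<lambda>k. f k \<odot>\<^bsub>sect F U\<^esub> e k) I"

definition basis_on ::
    "'n::finite pt set \<Rightarrow> ('n pt, 'm) omodule \<Rightarrow> 'n pt set \<Rightarrow> 'k set \<Rightarrow> ('k \<Rightarrow> 'm) \<Rightarrow> bool" where
  "basis_on X F U I e \<longleftrightarrow> e ` I \<subseteq> Sec F U \<and>
     (\<forall>W\<in>Op X U. \<forall>s\<in>Sec F W. \<exists>!f. f \<in> (I \<rightarrow>\<^sub>E \<O> X W) \<and>
        s = lin_comb F W I f (\<lambda>k. rest F U W (e k)))"

definition generated_on ::
    "'n::finite pt set \<Rightarrow> ('n pt, 'm) omodule \<Rightarrow> 'n pt set \<Rightarrow> nat \<Rightarrow> (nat \<Rightarrow> 'm) \<Rightarrow> bool" where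
  "generated_on X F U k e \<longleftrightarrow> e ` {..<k} \<subseteq> Sec F U \<and>
     (\<forall>W\<in>Op X U. \<forall>s\<in>Sec F W. \<forall>x\<in>W. \<exists>W'\<in>Op X W. x \<in> W' \<and>
        (\<exists>f\<in>{..<k} \<rightarrow> \<O> X W'. rest F W W' s = lin_comb F W' {..<k} f (\<lambda>i. rest F U W' (e i))))"

text \<open>Coherent sheaves on a variety: locally the cokernel of a map between free sheaves of finite
  rank. Here \<open>e\<close> generates and the rows of \<open>r\<close> generate the relations.\<close>

definition coherent :: "'n::finite pt set \<Rightarrow> ('n pt, 'm) omodule \<Rightarrow> bool" where
  "coherent X F \<longleftrightarrow> sheaf_of_modules X F \<and>
     (\<forall>x\<in>X. \<exists>U\<in>Op X X. x \<in> U \<and>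
       (\<exists>k e (l :: nat) r. generated_on X F U k e \<and>
          (\<forall>j<l. r j \<in> {..<k} \<rightarrow> \<O> X U \<and> lin_comb F U {..<k} (r j) e = \<zero>\<^bsub>sect F U\<^esub>) \<and>
          (\<forall>W\<in>Op X U. \<forall>f\<in>{..<k} \<rightarrow> \<O> X W.
             lin_comb F W {..<k} f (\<lambda>i. rest F U W (e i)) = \<zero>\<^bsub>sect F W\<^esub> \<longrightarrow>
             (\<forall>x\<in>W. \<exists>W'\<in>Op X W. x \<in> W' \<and>
                (\<exists>g\<in>{..<l} \<rightarrow> \<O> X W'. \<forall>i<k. \<forall>y\<in>W'. f i y = (\<Sum>j<l. g j y * r j i y))))))"

definition torsion_free :: "'n::finite pt set \<Rightarrow> ('n pt, 'm) omodule \<Rightarrow> bool" where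
  "torsion_free X F \<longleftrightarrow>
     (\<forall>U\<in>Op X X. \<forall>f\<in>\<O> X U. \<forall>s\<in>Sec F U. U \<noteq> {} \<longrightarrow>
        f \<odot>\<^bsub>sect F U\<^esub> s = \<zero>\<^bsub>sect F U\<^esub> \<longrightarrow> f = \<zero>\<^bsub>reg_ring X U\<^esub> \<or> s = \<zero>\<^bsub>sect F U\<^esub>)"

text \<open>The dimension of the generic stalk over the function field (\<open>X\<close> is irreducible, so any two
  nonempty open sets meet).\<close>

definition sheaf_rank :: "'n::finite pt set \<Rightarrow> ('n pt, 'm) omodule \<Rightarrow> nat" where
  "sheaf_rank X F = the_enat (Sup {enat k | k.
     \<exists>U\<in>Op X X. U \<noteq> {} \<and> (\<exists>e\<in>{..<k} \<rightarrow> Sec F U.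
       \<forall>W\<in>Op X U. W \<noteq> {} \<longrightarrow> (\<forall>f\<in>{..<k} \<rightarrow> \<O> X W.
         lin_comb F W {..<k} f (\<lambda>i. rest F U W (e i)) = \<zero>\<^bsub>sect F W\<^esub> \<longrightarrow>
         (\<forall>i<k. f i = \<zero>\<^bsub>reg_ring X W\<^esub>)))})"

text \<open>A subsheaf is given by its sections; it is empty on sets that are not open, so that equality
  of subsheaves is equality of functions.\<close>

definition subsheaf ::
    "'n::finite pt set \<Rightarrow> ('n pt, 'm) omodule \<Rightarrow> ('n pt set \<Rightarrow> 'm set) \<Rightarrow> bool" where
  "subsheaf X F S \<longleftrightarrow>
     (\<forall>U. U \<notin> Op X X \<longrightarrow> S U = {}) \<and>
     (\<forall>U\<in>Op X X. submodule (S U) (reg_ring X U) (sect F U) \<and>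
        (\<forall>W\<in>Op X U. rest F U W ` S U \<subseteq> S W) \<and>
        (\<forall>s\<in>Sec F U. (\<forall>x\<in>U. \<exists>W\<in>Op X U. x \<in> W \<and> rest F U W s \<in> S W) \<longrightarrow> s \<in> S U))"

definition zero_subsheaf ::
    "'n::finite pt set \<Rightarrow> ('n pt, 'm) omodule \<Rightarrow> 'n pt set \<Rightarrow> 'm set" where
  "zero_subsheaf X F U = (if U \<in> Op X X then {\<zero>\<^bsub>sect F U\<^esub>} else {})"

definition whole_subsheaf ::
    "'n::finite pt set \<Rightarrow> ('n pt, 'm) omodule \<Rightarrow> 'n pt set \<Rightarrow> 'm set" where
  "whole_subsheaf X F U = (if U \<in> Op X X then Sec F U else {})"

definition of_subsheaf ::
    "('p, 'm) omodule \<Rightarrow> ('p set \<Rightarrow> 'm set) \<Rightarrow> ('p, 'm) omodule" where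
  "of_subsheaf F S = F\<lparr>sect := (\<lambda>U. (sect F U)\<lparr>carrier := S U\<rparr>)\<rparr>"

text \<open>The class in the stalk at \<open>x\<close> of \<open>F/S\<close> of a section \<open>s\<close> of \<open>F\<close> over \<open>U\<close>.\<close>

definition quot_germ ::
    "'n::finite pt set \<Rightarrow> ('n pt, 'm) omodule \<Rightarrow> ('n pt set \<Rightarrow> 'm set) \<Rightarrow>
     'n pt \<Rightarrow> 'n pt set \<Rightarrow> 'm \<Rightarrow> ('n pt set \<times> 'm) set" where
  "quot_germ X F S x U s =
     {(W, t). W \<in> Op X X \<and> x \<in> W \<and> t \<in> Sec F W \<and>
        (\<exists>W'\<in>Op X (U \<inter> W). x \<in> W' \<and> rest F U W' s \<ominus>\<^bsub>sect F W'\<^esub> rest F W W' t \<in> S W')}"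

text \<open>The quotient sheaf, as the sheafification of the presheaf quotient: a section is a family of
  germs that locally comes from a section of \<open>F\<close>.\<close>

definition quot_sheaf ::
    "'n::finite pt set \<Rightarrow> ('n pt, 'm) omodule \<Rightarrow> ('n pt set \<Rightarrow> 'm set) \<Rightarrow>
     ('n pt, 'n pt \<Rightarrow> ('n pt set \<times> 'm) set) omodule" where
  "quot_sheaf X F S =
     \<lparr>sect = (\<lambda>U. mk_module
        {\<sigma> \<in> extensional U. \<forall>x\<in>U. \<exists>W\<in>Op X U. x \<in> W \<and>
            (\<exists>s\<in>Sec F W. \<forall>y\<in>W. \<sigma> y = quot_germ X F S y W s)}
        (\<lambda>x\<in>U. quot_germ X F S x U (\<zero>\<^bsub>sect F U\<^esub>))
        (\<lambda>\<sigma> \<tau>. \<lambda>x\<in>U. \<Union>(W, s)\<in>\<sigma> x. \<Union>(W', t)\<in>\<tau> x.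
            quot_germ X F S x (W \<inter> W')
              (rest F W (W \<inter> W') s \<oplus>\<^bsub>sect F (W \<inter> W')\<^esub> rest F W' (W \<inter> W') t))
        (\<lambda>f \<sigma>. \<lambda>x\<in>U. \<Union>(W, s)\<in>\<sigma> x.
            quot_germ X F S x (U \<inter> W)
              (restrict f (U \<inter> W) \<odot>\<^bsub>sect F (U \<inter> W)\<^esub> rest F W (U \<inter> W) s))),
      rest = (\<lambda>U W \<sigma>. restrict \<sigma> W)\<rparr>"

definition direct_sum ::
    "('p, 'a) omodule \<Rightarrow> ('p, 'b) omodule \<Rightarrow> ('p, 'a \<times> 'b) omodule" where
  "direct_sum A B =
     \<lparr>sect = (\<lambda>U. mk_module (Sec A U \<times> Sec B U) (\<zero>\<^bsub>sect A U\<^esub>, \<zero>\<^bsub>sect B U\<^esub>)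
         (\<lambda>(a, b) (a', b'). (a \<oplus>\<^bsub>sect A U\<^esub> a', b \<oplus>\<^bsub>sect B U\<^esub> b'))
         (\<lambda>f (a, b). (f \<odot>\<^bsub>sect A U\<^esub> a, f \<odot>\<^bsub>sect B U\<^esub> b))),
      rest = (\<lambda>U W (a, b). (rest A U W a, rest B U W b))\<rparr>"


section \<open>Cohomology\<close>

text \<open>Cech cohomology of the cover of \<open>X\<close> by the affine sets where a homogeneous coordinate does not
  vanish; for coherent sheaves this is sheaf cohomology. All index tuples are used, which gives the
  same cohomology as alternating cochains.\<close>

definition chart :: "'n::finite pt set \<Rightarrow> 'n list \<Rightarrow> 'n pt set" where
  "chart X js = {x \<in> X. \<forall>j\<in>set js. \<exists>v\<in>x. v $ j \<noteq> 0}"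

definition cochains ::
    "'n::finite pt set \<Rightarrow> ('n pt, 'm) omodule \<Rightarrow> nat \<Rightarrow> ('n list \<Rightarrow> 'm) set" where
  "cochains X F q = (\<Pi>\<^sub>E js\<in>{js. length js = Suc q}. Sec F (chart X js))"

definition cobdry ::
    "'n::finite pt set \<Rightarrow> ('n pt, 'm) omodule \<Rightarrow> nat \<Rightarrow> ('n list \<Rightarrow> 'm) \<Rightarrow> 'n list \<Rightarrow> 'm" where
  "cobdry X F q c =
     (\<lambda>js\<in>{js. length js = Suc (Suc q)}.
        finsum (sect F (chart X js))
          (\<lambda>i. let ks = take i js @ drop (Suc i) js;
                   s = rest F (chart X ks) (chart X js) (c ks)
               in if even i then s else \<ominus>\<^bsub>sect F (chart X js)\<^esub> s)
          {..Suc q})"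

definition zero_cochain ::
    "'n::finite pt set \<Rightarrow> ('n pt, 'm) omodule \<Rightarrow> nat \<Rightarrow> 'n list \<Rightarrow> 'm" where
  "zero_cochain X F q = (\<lambda>js\<in>{js. length js = Suc q}. \<zero>\<^bsub>sect F (chart X js)\<^esub>)"

definition cocycles ::
    "'n::finite pt set \<Rightarrow> ('n pt, 'm) omodule \<Rightarrow> nat \<Rightarrow> ('n list \<Rightarrow> 'm) set" where
  "cocycles X F q = {c \<in> cochains X F q. cobdry X F q c = zero_cochain X F (Suc q)}"

definition coboundaries ::
    "'n::finite pt set \<Rightarrow> ('n pt, 'm) omodule \<Rightarrow> nat \<Rightarrow> ('n list \<Rightarrow> 'm) set" where
  "coboundaries X F q =
     (case q of 0 \<Rightarrow> {zero_cochain X F 0} | Suc r \<Rightarrow> cobdry X F r ` cochains X F r)"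

text \<open>The complex dimension of cocycles modulo coboundaries.\<close>

definition coh_dim :: "'n::finite pt set \<Rightarrow> ('n pt, 'm) omodule \<Rightarrow> nat \<Rightarrow> enat" where
  "coh_dim X F q = Sup {enat k | k. \<exists>c\<in>{..<k} \<rightarrow> cocycles X F q.
     \<forall>a :: nat \<Rightarrow> complex.
       (\<lambda>js\<in>{js. length js = Suc q}.
          lin_comb F (chart X js) {..<k} (\<lambda>i. \<lambda>x\<in>chart X js. a i) (\<lambda>i. c i js))
         \<in> coboundaries X F q \<longrightarrow>
       (\<forall>i<k. a i = 0)}"

text \<open>The cover has \<open>CARD('n)\<close> members, so higher cohomology vanishes.\<close>

definition euler_char :: "'n::finite pt set \<Rightarrow> ('n pt, 'm) omodule \<Rightarrow> int" where
  "euler_char X F = (\<Sum>q<CARD('n). (-1) ^ q * int (the_enat (coh_dim X F q)))"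


section \<open>Polarized K3 surfaces\<close>

text \<open>A variety of dimension 2 is smooth iff its local rings are regular, i.e. every maximal ideal
  is generated by two germs.\<close>

definition smooth_surface :: "'n::finite pt set \<Rightarrow> bool" where
  "smooth_surface X \<longleftrightarrow> closedin zariski_space X \<and> irreducible_closed (zariski X) X \<and>
     krull_dim (zariski X) = 2 \<and>
     (\<forall>x\<in>X. \<exists>U\<in>Op X X. x \<in> U \<and> (\<exists>f\<in>\<O> X U. \<exists>g\<in>\<O> X U. f x = 0 \<and> g x = 0 \<and>
        (\<forall>W\<in>Op X U. \<forall>h\<in>\<O> X W. x \<in> W \<and> h x = 0 \<longrightarrow>
           (\<exists>W'\<in>Op X W. x \<in> W' \<and> (\<exists>a\<in>\<O> X W'. \<exists>b\<in>\<O> X W'.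
              \<forall>y\<in>W'. h y = a y * f y + b y * g y)))))"

definition K3_surface :: "'n::finite pt set \<Rightarrow> bool" where
  "K3_surface X \<longleftrightarrow> smooth_surface X \<and> coh_dim X (structure_sheaf X) 1 = 0 \<and>
     isomorphic_sheaves X (structure_sheaf X) (canonical_sheaf X)"

definition line_bundle :: "'n::finite pt set \<Rightarrow> ('n pt, 'l) omodule \<Rightarrow> bool" where
  "line_bundle X L \<longleftrightarrow> sheaf_of_modules X L \<and>
     (\<forall>x\<in>X. \<exists>U\<in>Op X X. x \<in> U \<and> (\<exists>e. basis_on X L U (UNIV :: unit set) e))"

definition nonvanishing ::
    "'n::finite pt set \<Rightarrow> ('n pt, 'l) omodule \<Rightarrow> 'l \<Rightarrow> 'n pt set" where
  "nonvanishing X L s =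
     {x \<in> X. \<exists>W\<in>Op X X. x \<in> W \<and> basis_on X L W (UNIV :: unit set) (\<lambda>_. rest L X W s)}"

text \<open>EGA II, 4.5.2-4.5.3: \<open>L\<close> is ample iff the nonvanishing sets of the sections of its positive
  powers form a base of the topology.\<close>

definition ample :: "'n::finite pt set \<Rightarrow> ('n pt, 'l) omodule \<Rightarrow> bool" where
  "ample X L \<longleftrightarrow> line_bundle X L \<and>
     (\<forall>U\<in>Op X X. \<forall>x\<in>U. \<exists>k\<ge>1. \<exists>s\<in>Sec (twist X L (structure_sheaf X) k) X.
        x \<in> nonvanishing X (twist X L (structure_sheaf X) k) s \<and>
        nonvanishing X (twist X L (structure_sheaf X) k) s \<subseteq> U)"


section \<open>Gieseker semistability\<close>

definition hilbert_poly ::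
    "'n::finite pt set \<Rightarrow> ('n pt, 'l) omodule \<Rightarrow> ('n pt, 'm) omodule \<Rightarrow> nat \<Rightarrow> int" where
  "hilbert_poly X L F m = euler_char X (twist X L F m)"

definition reduced_hilbert ::
    "'n::finite pt set \<Rightarrow> ('n pt, 'l) omodule \<Rightarrow> ('n pt, 'm) omodule \<Rightarrow> nat \<Rightarrow> real" where
  "reduced_hilbert X L F m = of_int (hilbert_poly X L F m) / of_nat (sheaf_rank X F)"

definition gieseker_semistable ::
    "'n::finite pt set \<Rightarrow> ('n pt, 'l) omodule \<Rightarrow> ('n pt, 'm) omodule \<Rightarrow> bool" where
  "gieseker_semistable X L F \<longleftrightarrow> coherent X F \<and> torsion_free X F \<and>
     (\<forall>S. subsheaf X F S \<and> coherent X (of_subsheaf F S) \<and> S \<noteq> zero_subsheaf X F \<and>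
          sheaf_rank X (of_subsheaf F S) < sheaf_rank X F \<longrightarrow>
        (\<forall>\<^sub>F m in sequentially.
           reduced_hilbert X L (of_subsheaf F S) m \<le> reduced_hilbert X L F m))"

definition filtration_step ::
    "'n::finite pt set \<Rightarrow> ('n pt, 'm) omodule \<Rightarrow> ('n pt set \<Rightarrow> 'm set) list \<Rightarrow> nat \<Rightarrow>
     'n pt set \<Rightarrow> 'm set" where
  "filtration_step X F Fs i = (case i of 0 \<Rightarrow> zero_subsheaf X F | Suc k \<Rightarrow> Fs ! k)"

definition graded_piece ::
    "'n::finite pt set \<Rightarrow> ('n pt, 'm) omodule \<Rightarrow> ('n pt set \<Rightarrow> 'm set) list \<Rightarrow> nat \<Rightarrow>
     ('n pt, 'n pt \<Rightarrow> ('n pt set \<times> 'm) set) omodule" where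
  "graded_piece X F Fs i =
     quot_sheaf X (of_subsheaf F (filtration_step X F Fs (Suc i))) (filtration_step X F Fs i)"

text \<open>The list \<open>[F\<^sub>1, \<dots>, F\<^sub>t\<^sub>+\<^sub>1]\<close> represents \<open>0 \<subset> F\<^sub>1 \<subset> \<cdots> \<subset> F\<^sub>t\<^sub>+\<^sub>1 = F\<close>.\<close>

definition is_gieseker_HN_filtration ::
    "'n::finite pt set \<Rightarrow> ('n pt, 'l) omodule \<Rightarrow> ('n pt, 'm) omodule \<Rightarrow>
     ('n pt set \<Rightarrow> 'm set) list \<Rightarrow> bool" where
  "is_gieseker_HN_filtration X L F Fs \<longleftrightarrow>
     filtration_step X F Fs (length Fs) = whole_subsheaf X F \<and>
     (\<forall>i<length Fs.
        subsheaf X F (Fs ! i) \<and> filtration_step X F Fs i < Fs ! i \<and>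
        gieseker_semistable X L (graded_piece X F Fs i)) \<and>
     (\<forall>i. Suc i < length Fs \<longrightarrow>
        (\<forall>\<^sub>F m in sequentially.
           reduced_hilbert X L (graded_piece X F Fs i) m
             > reduced_hilbert X L (graded_piece X F Fs (Suc i)) m))"


section \<open>The symplectic group and its parabolic subgroups\<close>

text \<open>\<open>\<complex>\<^sup>6\<close> is indexed by two copies of a three element type; the standard form pairs them.\<close>

type_synonym six = "3 + 3"
type_synonym mat6 = "complex ^ six ^ six"

definition sympl_J :: mat6 where
  "sympl_J = (\<chi> k l. case (k, l) of
       (Inl i, Inr j) \<Rightarrow> if i = j then 1 else 0
     | (Inr i, Inl j) \<Rightarrow> if i = j then -1 else 0
     | _ \<Rightarrow> 0)"

definition Sp6 :: "mat6 set" where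
  "Sp6 = {A. transpose A ** sympl_J ** A = sympl_J}"

text \<open>Homomorphisms of algebraic groups \<open>\<complex>\<^sup>* \<rightarrow> Sp(6)\<close>: the entries are Laurent polynomials. The
  value at \<open>0\<close> is irrelevant.\<close>

definition one_param_subgroup :: "(complex \<Rightarrow> mat6) \<Rightarrow> bool" where
  "one_param_subgroup lam \<longleftrightarrow>
     (\<forall>t. t \<noteq> 0 \<longrightarrow> lam t \<in> Sp6) \<and>
     (\<forall>s t. s \<noteq> 0 \<longrightarrow> t \<noteq> 0 \<longrightarrow> lam (s * t) = lam s ** lam t) \<and>
     (\<forall>k l. \<exists>(q :: complex poly) r. \<forall>t. t \<noteq> 0 \<longrightarrow> lam t $ k $ l = poly q t / t ^ r)"

definition parabolic :: "(complex \<Rightarrow> mat6) \<Rightarrow> mat6 set" where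
  "parabolic lam =
     {g \<in> Sp6. \<exists>h\<in>Sp6. ((\<lambda>t. lam t ** g ** matrix_inv (lam t)) \<longlongrightarrow> h) at_infinity}"

definition weight_space :: "(complex \<Rightarrow> mat6) \<Rightarrow> int \<Rightarrow> (complex ^ six) set" where
  "weight_space lam \<gamma> = {v. \<forall>t. t \<noteq> 0 \<longrightarrow> lam t *v v = (t powi \<gamma>) *s v}"

definition weights :: "(complex \<Rightarrow> mat6) \<Rightarrow> int set" where
  "weights lam = {\<gamma>. weight_space lam \<gamma> \<noteq> {0}}"

definition weight_flag :: "(complex \<Rightarrow> mat6) \<Rightarrow> int \<Rightarrow> (complex ^ six) set" where
  "weight_flag lam \<gamma> = vec.span (\<Union>\<beta>\<in>{\<beta>\<in>weights lam. \<beta> \<le> \<gamma>}. weight_space lam \<beta>)"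


section \<open>Symplectic frame bundles and parabolic reductions\<close>

text \<open>A principal bundle is represented by its sheaf of sections. For the principal bundle of a
  symplectic bundle \<open>(B, \<omega>)\<close> of rank 6 these are the symplectic frames, with the matrix group
  acting on the right; a frame is the same as a symplectic isomorphism from the trivial bundle.
  Parabolic subgroups of \<open>Sp(6)\<close> are special groups, so their torsors are Zariski locally trivial.\<close>

definition symplectic_frames ::
    "'n::finite pt set \<Rightarrow> ('n pt, 'm) omodule \<Rightarrow> ('n pt set \<Rightarrow> 'm \<Rightarrow> 'm \<Rightarrow> 'n pt \<Rightarrow> complex) \<Rightarrow>
     'n pt set \<Rightarrow> (six \<Rightarrow> 'm) set" where
  "symplectic_frames X B \<omega> U =
     (if U \<in> Op X X
      then {e. basis_on X B U UNIV e \<and> (\<forall>k l. \<omega> U (e k) (e l) = (\<lambda>x\<in>U. sympl_J $ k $ l))}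
      else {})"

definition regular_maps ::
    "'n::finite pt set \<Rightarrow> 'n pt set \<Rightarrow> mat6 set \<Rightarrow> ('n pt \<Rightarrow> mat6) set" where
  "regular_maps X U P =
     {g. (\<forall>x\<in>U. g x \<in> P) \<and> (\<forall>k l. (\<lambda>x\<in>U. g x $ k $ l) \<in> \<O> X U)}"

definition frame_act ::
    "('p, 'm) omodule \<Rightarrow> 'p set \<Rightarrow> (six \<Rightarrow> 'm) \<Rightarrow> ('p \<Rightarrow> mat6) \<Rightarrow> six \<Rightarrow> 'm" where
  "frame_act B U e g = (\<lambda>l. lin_comb B U UNIV (\<lambda>k. \<lambda>x\<in>U. g x $ k $ l) e)"

text \<open>A reduction of \<open>E\<close> to \<open>P\<close> over \<open>U\<close>: a \<open>P\<close>-subtorsor of \<open>E\<close> restricted to \<open>U\<close>.\<close>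

definition reduction ::
    "'n::finite pt set \<Rightarrow> ('n pt, 'm) omodule \<Rightarrow> ('n pt set \<Rightarrow> (six \<Rightarrow> 'm) set) \<Rightarrow>
     'n pt set \<Rightarrow> mat6 set \<Rightarrow> ('n pt set \<Rightarrow> (six \<Rightarrow> 'm) set) \<Rightarrow> bool" where
  "reduction X B E U P R \<longleftrightarrow>
     (\<forall>W\<in>Op X U.
        R W \<subseteq> E W \<and>
        (\<forall>e\<in>R W. \<forall>W'\<in>Op X W. rest B W W' \<circ> e \<in> R W') \<and>
        (\<forall>e\<in>E W. (\<forall>x\<in>W. \<exists>W'\<in>Op X W. x \<in> W' \<and> rest B W W' \<circ> e \<in> R W') \<longrightarrow> e \<in> R W) \<and>
        (\<forall>e\<in>R W. \<forall>g\<in>regular_maps X W P. frame_act B W e g \<in> R W) \<and>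
        (\<forall>e\<in>R W. \<forall>e'\<in>R W. \<exists>g\<in>regular_maps X W P. e' = frame_act B W e g)) \<and>
     (\<forall>x\<in>U. \<exists>W\<in>Op X U. x \<in> W \<and> R W \<noteq> {})"

text \<open>The subbundle of \<open>B\<close> over \<open>U\<close> associated with the reduction \<open>R\<close> and an invariant subspace \<open>Y\<close>
  of \<open>\<complex>\<^sup>6\<close>: the class of \<open>(e, w)\<close> in the associated bundle of \<open>E\<close> is identified with the section
  \<open>e(w)\<close> of \<open>B\<close>.\<close>

definition associated_sub ::
    "'n::finite pt set \<Rightarrow> ('n pt, 'm) omodule \<Rightarrow> ('n pt set \<Rightarrow> (six \<Rightarrow> 'm) set) \<Rightarrow>
     (complex ^ six) set \<Rightarrow> 'n pt set \<Rightarrow> 'm set" where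
  "associated_sub X B R Y W =
     {s \<in> Sec B W. \<forall>x\<in>W. \<exists>W'\<in>Op X W. x \<in> W' \<and>
        (\<exists>e\<in>R W'. \<exists>w :: 'n pt \<Rightarrow> complex ^ six.
           (\<forall>y\<in>W'. w y \<in> Y) \<and> (\<forall>k. (\<lambda>y\<in>W'. w y $ k) \<in> \<O> X W') \<and>
           rest B W W' s = lin_comb B W' UNIV (\<lambda>k. \<lambda>y\<in>W'. w y $ k) e)}"

text \<open>\<open>\<iota>\<^sub>* F\<^sup>U \<inter> B\<close>.\<close>

definition saturated_extension ::
    "'n::finite pt set \<Rightarrow> ('n pt, 'm) omodule \<Rightarrow> 'n pt set \<Rightarrow> ('n pt set \<Rightarrow> 'm set) \<Rightarrow>
     'n pt set \<Rightarrow> 'm set" where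
  "saturated_extension X B U S W =
     (if W \<in> Op X X then {s \<in> Sec B W. rest B W (W \<inter> U) s \<in> S (W \<inter> U)} else {})"

definition corresponds_to_parabolic_reduction ::
    "'n::finite pt set \<Rightarrow> ('n pt, 'm) omodule \<Rightarrow> ('n pt set \<Rightarrow> (six \<Rightarrow> 'm) set) \<Rightarrow>
     ('n pt set \<Rightarrow> 'm set) list \<Rightarrow> bool" where
  "corresponds_to_parabolic_reduction X B E Fs \<longleftrightarrow>
     (\<exists>lam U R. one_param_subgroup lam \<and> big_open X U \<and> reduction X B E U (parabolic lam) R \<and>
        Fs = map (\<lambda>\<gamma>. saturated_extension X B U (associated_sub X B R (weight_flag lam \<gamma>)))
               (sorted_list_of_set (weights lam)))"


section \<open>The symplectic bundle and the filtration\<close>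

definition with_dual ::
    "'n::finite pt set \<Rightarrow> ('n pt, 'v) omodule \<Rightarrow>
     ('n pt, 'v \<times> ('n pt set \<Rightarrow> 'v \<Rightarrow> 'n pt \<Rightarrow> complex)) omodule" where
  "with_dual X V = direct_sum V (dual_sheaf X V)"

definition duality_form ::
    "'n pt set \<Rightarrow> 'v \<times> ('n pt set \<Rightarrow> 'v \<Rightarrow> 'n pt \<Rightarrow> complex) \<Rightarrow>
     'v \<times> ('n pt set \<Rightarrow> 'v \<Rightarrow> 'n pt \<Rightarrow> complex) \<Rightarrow> 'n pt \<Rightarrow> complex" where
  "duality_form U = (\<lambda>(v, f) (w, g). \<lambda>x\<in>U. g U v x - f U w x)"

text \<open>The image of \<open>\<O>\<close> in the dual of \<open>V\<close> under the dual of \<open>p : V \<rightarrow> \<O>\<close>, \<open>h \<mapsto> h \<cdot> p\<close>.\<close>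

definition dual_image ::
    "'n::finite pt set \<Rightarrow> ('n pt, 'v) omodule \<Rightarrow> ('n pt set \<Rightarrow> 'v \<Rightarrow> 'n pt \<Rightarrow> complex) \<Rightarrow>
     'n pt set \<Rightarrow> ('n pt set \<Rightarrow> 'v \<Rightarrow> 'n pt \<Rightarrow> complex) set" where
  "dual_image X V p U =
     {h \<odot>\<^bsub>sect (dual_sheaf X V) U\<^esub> restrict p (Op X U) | h. h \<in> \<O> X U}"

definition claimed_filtration ::
    "'n::finite pt set \<Rightarrow> ('n pt, 'v) omodule \<Rightarrow> ('n pt set \<Rightarrow> 'v \<Rightarrow> 'n pt \<Rightarrow> complex) \<Rightarrow>
     ('n pt set \<Rightarrow> ('v \<times> ('n pt set \<Rightarrow> 'v \<Rightarrow> 'n pt \<Rightarrow> complex)) set) list" where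
  "claimed_filtration X V p =
     [\<lambda>U. if U \<in> Op X X then {\<zero>\<^bsub>sect V U\<^esub>} \<times> dual_image X V p U else {},
      \<lambda>U. if U \<in> Op X X then Sec V U \<times> dual_image X V p U else {},
      whole_subsheaf X (with_dual X V)]"

end

(* If lam has exactly three weights, they are -a < 0 < a because lam is symplectic, so the first step
  of the flag of lam is orthogonal to the second, and this remains true after moving one of them by
  an element of the parabolic subgroup. Hence the first two steps of a filtration of length three
  that comes from a parabolic reduction are orthogonal over the nonempty open set U. The claimed
  filtration violates this: near any point there is a section v of V with p v = 1, and the sections
  (0, p) and (v, 0) of the first two steps pair to -1. *)

theory Submission
  imports Defs
begin

section \<open>Flags of one-parameter subgroups\<close>

text \<open>A reduction is given only through local frames, and a section of the first step and one
  of the second may be expanded in different frames of it. Such frames differ by a transition matrix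
  \<open>g\<close> with values in the parabolic. The linear algebra therefore has to give
  \<open>sympl_form v (g *v w) = 0\<close>, which is more than orthogonality of two steps of one
  fixed flag. The reason is a scaling argument: conjugating \<open>g\<close> by \<open>lam t\<close>
  multiplies its pairing between weights \<gamma> and \<beta> by a power of \<open>t\<close>
  determined by \<gamma> + \<beta>, while the conjugates of \<open>g\<close> converge as
  \<open>t\<close> tends to infinity. Letting the flags collect the small weights matches this
  choice of limit.

  On the sheaf side everything happens at one point of \<open>U\<close>. The work there is to turn
  linear combinations of sections, which are sums in modules of pairs and families of maps, into
  sums of complex numbers.\<close>

definition sympl_form :: "complex ^ six \<Rightarrow> complex ^ six \<Rightarrow> complex" where
  "sympl_form v w = (\<Sum>k\<in>UNIV. v $ k * (sympl_J *v w) $ k)"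

lemma sympl_form_linear:
  "sympl_form (v + v') w = sympl_form v w + sympl_form v' w"
  "sympl_form (c *s v) w = c * sympl_form v w"
  "sympl_form v (w + w') = sympl_form v w + sympl_form v w'"
  "sympl_form v (c *s w) = c * sympl_form v w"
  "sympl_form 0 w = 0"
  "sympl_form v 0 = 0"
  by (simp_all add: sympl_form_def matrix_vector_right_distrib vector_scalar_commute
      sum.distrib sum_distrib_left algebra_simps)

lemma sum_mult_matrix_vector:
  fixes A :: "complex ^ 'a::finite ^ 'b::finite"
  shows "(\<Sum>k\<in>UNIV. (A *v v) $ k * u $ k) = (\<Sum>k\<in>UNIV. v $ k * (transpose A *v u) $ k)"
proof -
  have "(\<Sum>k\<in>UNIV. (A *v v) $ k * u $ k) = (\<Sum>k\<in>UNIV. \<Sum>l\<in>UNIV. A $ k $ l * v $ l * u $ k)"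
    by (simp add: matrix_vector_mult_def sum_distrib_right)
  also have "\<dots> = (\<Sum>l\<in>UNIV. \<Sum>k\<in>UNIV. A $ k $ l * v $ l * u $ k)"
    by (rule sum.swap)
  finally show ?thesis
    by (simp add: matrix_vector_mult_def transpose_def sum_distrib_left mult_ac)
qed

lemma Sp6_sympl_form:
  assumes "A \<in> Sp6"
  shows "sympl_form (A *v v) (A *v w) = sympl_form v w"
proof -
  have "transpose A *v (sympl_J *v (A *v w)) = sympl_J *v w"
    using assms by (simp add: Sp6_def matrix_vector_mul_assoc matrix_mul_assoc)
  then show ?thesis
    by (simp add: sympl_form_def sum_mult_matrix_vector)
qed

lemma sum_UNIV_sum:
  fixes f :: "'a::finite + 'b::finite \<Rightarrow> 'c::comm_monoid_add"
  shows "(\<Sum>k\<in>UNIV. f k) = (\<Sum>i\<in>UNIV. f (Inl i)) + (\<Sum>i\<in>UNIV. f (Inr i))"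
proof -
  have "(\<Sum>k\<in>UNIV. f k) = sum f (range Inl \<union> range Inr)"
    by (simp add: UNIV_sum)
  also have "\<dots> = sum f (range Inl) + sum f (range Inr)"
    by (rule sum.union_disjoint) auto
  finally show ?thesis
    by (simp add: sum.reindex)
qed

lemma sympl_J_entries:
  "sympl_J $ Inl i $ Inl j = 0"
  "sympl_J $ Inl i $ Inr j = (if i = j then 1 else 0)"
  "sympl_J $ Inr i $ Inl j = (if i = j then -1 else 0)"
  "sympl_J $ Inr i $ Inr j = 0"
  by (simp_all add: sympl_J_def)

lemma sympl_J_square: "sympl_J ** sympl_J = - mat 1"
proof -
  have "(sympl_J ** sympl_J) $ k $ l = (- mat 1 :: mat6) $ k $ l" for k l
    by (cases k; cases l) (simp_all add: matrix_matrix_mult_def mat_def sum_UNIV_sum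
        sympl_J_entries if_distrib if_distribR cong: if_cong)
  then show ?thesis by (simp add: vec_eq_iff)
qed

lemma matrix_vector_mult_uminus_left: "(- A) *v v = - (A *v v)"
  for A :: "'a::comm_ring_1 ^ 'n ^ 'm"
  by (simp add: vec_eq_iff matrix_vector_mult_def sum_negf)

text \<open>Since \<open>sympl_J\<close> squares to -1, pairing \<open>v\<close> with
  \<open>sympl_J *v axis k 1\<close> returns \<open>- v $ k\<close>, so every coordinate can be read
  off.\<close>

lemma sympl_form_nondegenerate:
  assumes "\<And>w. sympl_form v w = 0"
  shows "v = 0"
proof -
  have "v $ k = 0" for k
  proof -
    have "sympl_form v (sympl_J *v axis k 1) = (\<Sum>l\<in>UNIV. v $ l * ((- mat 1) *v axis k 1) $ l)"
      by (simp add: sympl_form_def matrix_vector_mul_assoc sympl_J_square)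
    also have "\<dots> = - v $ k"
      by (simp add: matrix_vector_mult_uminus_left axis_def if_distrib sum_negf cong: if_cong)
    finally show ?thesis using assms by simp
  qed
  then show ?thesis by (simp add: vec_eq_iff)
qed

text \<open>Multiplying the defining equation on the left by \<open>- sympl_J\<close> exhibits a
  left inverse of \<open>A\<close>, which suffices for square matrices.\<close>

lemma Sp6_invertible:
  assumes "A \<in> Sp6"
  shows "invertible A"
proof -
  have "((- sympl_J) ** transpose A ** sympl_J) ** A = (- sympl_J) ** (transpose A ** sympl_J ** A)"
    by (simp add: matrix_mul_assoc)
  also have "\<dots> = - (sympl_J ** sympl_J)"
    using assms by (simp add: Sp6_def matrix_matrix_mult_def vec_eq_iff sum_negf)
  also have "\<dots> = mat 1"
    by (simp add: sympl_J_square)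
  finally show ?thesis
    by (metis invertible_left_inverse)
qed

text \<open>Comparing the coefficients of \<open>t ^ k\<close> in \<open>lam (s * t) = lam s ** lam t\<close> shows that the columns
  of the \<open>k\<close>-th Laurent coefficient matrix of \<open>lam\<close> are weight vectors; these matrices sum to
  \<open>lam 1 = 1\<close>.\<close>

lemma span_weight_spaces:
  assumes "one_param_subgroup lam"
  shows "vec.span (\<Union>\<gamma>\<in>weights lam. weight_space lam \<gamma>) = UNIV"
proof -
  have Sp: "\<And>t. t \<noteq> 0 \<Longrightarrow> lam t \<in> Sp6"
    and mult: "\<And>s t. s \<noteq> 0 \<Longrightarrow> t \<noteq> 0 \<Longrightarrow> lam (s * t) = lam s ** lam t"
    using assms by (auto simp: one_param_subgroup_def)
  obtain q :: "six \<Rightarrow> six \<Rightarrow> complex poly" and r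
    where qr: "\<And>k l t. t \<noteq> 0 \<Longrightarrow> lam t $ k $ l = poly (q k l) t / t ^ r k l"
    using assms unfolding one_param_subgroup_def by metis
  \<comment> \<open>A common bound for all pole orders at 0, so that \<open>t ^ N\<close> clears the
    denominators of every entry at once.\<close>
  define N where "N = (\<Sum>k\<in>UNIV. \<Sum>l\<in>UNIV. r k l)"
  have N: "r k l \<le> N" for k l
  proof -
    have "r k l \<le> (\<Sum>l\<in>UNIV. r k l)" by (rule member_le_sum) auto
    also have "\<dots> \<le> N" unfolding N_def by (rule member_le_sum [of k UNIV "\<lambda>k. \<Sum>l\<in>UNIV. r k l"]) auto
    finally show ?thesis .
  qed
  define Q where "Q k l = q k l * monom 1 (N - r k l)" for k l
  have Q: "poly (Q k l) t = t ^ N * lam t $ k $ l" if "t \<noteq> 0" for t k l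
    using that N[of k l] by (simp add: Q_def qr poly_monom field_simps flip: power_add)
  \<comment> \<open>Values at 0 must be avoided because \<open>lam 0\<close> is arbitrary.\<close>
  have poly_ext: "P = P'" if "\<And>t. t \<noteq> 0 \<Longrightarrow> poly P t = poly P' t" for P P' :: "complex poly"
  proof (rule ccontr)
    assume "P \<noteq> P'"
    then have "finite {t. poly (P - P') t = 0}" by (intro poly_roots_finite) auto
    moreover have "- {0} \<subseteq> {t. poly (P - P') t = 0}" using that by auto
    moreover have "infinite (- {0 :: complex})"
      by (simp add: infinite_UNIV_char_0 Compl_eq_Diff_UNIV)
    ultimately show False using finite_subset by blast
  qed
  define A :: "nat \<Rightarrow> mat6" where "A i = (\<chi> k l. coeff (Q k l) i)" for i
  \<comment> \<open>For fixed \<open>s\<close>, the homomorphism law becomes an identity of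
    polynomials in \<open>t\<close>; on the left \<open>t\<close> is replaced by
    \<open>s * t\<close>, which multiplies the i-th coefficient by \<open>s ^ i\<close>.\<close>
  have Q_hom: "pcompose (Q k l) [:0, s:] = (\<Sum>m\<in>UNIV. Polynomial.smult (s ^ N * lam s $ k $ m) (Q m l))"
    if "s \<noteq> 0" for s k l
  proof (rule poly_ext)
    fix t :: complex assume "t \<noteq> 0"
    then have "poly (pcompose (Q k l) [:0, s:]) t = (s * t) ^ N * (lam s ** lam t) $ k $ l"
      using that by (simp add: poly_pcompose Q mult mult.commute[of t s])
    also have "\<dots> = (\<Sum>m\<in>UNIV. s ^ N * lam s $ k $ m * (t ^ N * lam t $ m $ l))"
      by (simp add: matrix_matrix_mult_def sum_distrib_left power_mult_distrib mult_ac)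
    finally show "poly (pcompose (Q k l) [:0, s:]) t
        = poly (\<Sum>m\<in>UNIV. Polynomial.smult (s ^ N * lam s $ k $ m) (Q m l)) t"
      using \<open>t \<noteq> 0\<close> by (simp add: poly_sum Q)
  qed
  have A_col: "s ^ i * A i $ k $ l = s ^ N * (lam s ** A i) $ k $ l" if "s \<noteq> 0" for s i k l
  proof -
    have "s ^ i * A i $ k $ l = coeff (pcompose (Q k l) [:0, s:]) i"
      by (simp add: A_def coeff_pcompose_linear)
    then show ?thesis
      by (simp add: Q_hom[OF that] A_def coeff_sum matrix_matrix_mult_def sum_distrib_left mult.assoc)
  qed
  \<comment> \<open>\<open>A i\<close> belongs to the power \<open>t ^ i\<close> of
    \<open>t ^ N * lam t\<close>, hence the shift of the weight by \<open>N\<close>.\<close>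
  have weight: "A i *v v \<in> weight_space lam (int i - int N)" for i v
    unfolding weight_space_def
  proof (intro CollectI allI impI)
    fix t :: complex assume t: "t \<noteq> 0"
    have "lam t ** A i = (\<chi> k l. t powi (int i - int N) * A i $ k $ l)"
      using A_col[OF t] t by (simp add: vec_eq_iff power_int_diff field_simps)
    then show "lam t *v (A i *v v) = t powi (int i - int N) *s (A i *v v)"
      by (simp add: matrix_vector_mul_assoc)
         (simp add: vec_eq_iff matrix_vector_mult_def sum_distrib_left mult.assoc)
  qed
  define D where "D = (\<Sum>k\<in>UNIV. \<Sum>l\<in>UNIV. degree (Q k l))"
  have D: "degree (Q k l) \<le> D" for k l
  proof -
    have "degree (Q k l) \<le> (\<Sum>l\<in>UNIV. degree (Q k l))" by (rule member_le_sum) auto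
    also have "\<dots> \<le> D"
      unfolding D_def by (rule member_le_sum [of k UNIV "\<lambda>k. \<Sum>l\<in>UNIV. degree (Q k l)"]) auto
    finally show ?thesis .
  qed
  \<comment> \<open>An invertible idempotent is the identity.\<close>
  have "lam 1 ** lam 1 = lam 1" using mult[of 1 1] by simp
  moreover obtain M where "M ** lam 1 = mat 1"
    using Sp6_invertible[OF Sp[of 1]] by (auto simp: invertible_def)
  ultimately have "lam 1 = mat 1"
    by (metis matrix_mul_assoc matrix_mul_lid)
  moreover have "lam 1 $ k $ l = (\<Sum>i\<le>D. A i $ k $ l)" for k l
  proof -
    have "poly (Q k l) 1 = poly (\<Sum>i\<le>D. monom (coeff (Q k l) i) i) 1"
      by (simp only: poly_as_sum_of_monoms'[OF D])
    then show ?thesis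
      using Q[of 1 k l] by (simp add: A_def poly_sum poly_monom)
  qed
  ultimately have "mat 1 = (\<Sum>i\<le>D. A i)"
    by (simp add: vec_eq_iff)
  then have "v = (\<Sum>i\<le>D. A i) *v v" for v
    by (metis matrix_vector_mul_lid)
  moreover have "(\<Sum>i\<le>d. A i) *v v = (\<Sum>i\<le>d. A i *v v)" for d v
    by (induction d) (simp_all add: matrix_vector_mult_add_rdistrib)
  ultimately have decomp: "v = (\<Sum>i\<le>D. A i *v v)" for v
    by metis
  have "v \<in> vec.span (\<Union>\<gamma>\<in>weights lam. weight_space lam \<gamma>)" for v
  proof (subst decomp, rule vec.span_sum)
    fix i
    show "A i *v v \<in> vec.span (\<Union>\<gamma>\<in>weights lam. weight_space lam \<gamma>)"
    \<comment> \<open>The exponent of \<open>A i\<close> counts as a weight only if its weight space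
      contains a nonzero vector.\<close>
    proof (cases "A i *v v = 0")
      case False
      then have "int i - int N \<in> weights lam"
        using weight by (auto simp: weights_def)
      then show ?thesis
        using weight by (intro vec.span_base) blast
    qed (simp add: vec.span_zero)
  qed
  then show ?thesis by auto
qed

section \<open>Symmetry of the weights and isotropy of the weight flags\<close>

lemma zero_in_weight_space [simp]: "0 \<in> weight_space lam \<gamma>"
  by (simp add: weight_space_def)

text \<open>Bilinearity in both slots. The matrix \<open>g\<close> leaves room for a change of
  frame; the undistorted form is the case \<open>g = mat 1\<close>.\<close>

lemma sympl_form_span:
  assumes "v \<in> vec.span S" "w \<in> vec.span T"
    and 0: "\<And>v w. v \<in> S \<Longrightarrow> w \<in> T \<Longrightarrow> sympl_form v (g *v w) = 0"
  shows "sympl_form v (g *v w) = 0"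
  using assms(1)
proof (induction rule: vec.span_induct_alt)
  case (step c v v')
  have "sympl_form v (g *v w) = 0"
    using assms(2) by (induction rule: vec.span_induct_alt)
      (simp_all add: 0[OF step(1)] sympl_form_linear matrix_vector_right_distrib vector_scalar_commute)
  with step show ?case by (simp add: sympl_form_linear)
qed (simp add: sympl_form_linear)

text \<open>Invariance of the form forces vectors of weights \<gamma> and \<beta> to be orthogonal
  unless \<gamma> + \<beta> = 0. If -\<gamma> were not a weight, a vector of weight \<gamma> would
  be orthogonal to all weight spaces, hence to everything, against nondegeneracy.\<close>

lemma uminus_weight:
  assumes lam: "one_param_subgroup lam" and "\<gamma> \<in> weights lam"
  shows "- \<gamma> \<in> weights lam"
proof (rule ccontr)
  assume neg: "- \<gamma> \<notin> weights lam"
  obtain v where v: "v \<in> weight_space lam \<gamma>" "v \<noteq> 0"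
    using assms(2) zero_in_weight_space[of lam \<gamma>] unfolding weights_def by blast
  have orth: "sympl_form v w = 0" if "\<beta> \<in> weights lam" "w \<in> weight_space lam \<beta>" for \<beta> w
  proof -
    \<comment> \<open>One parameter value is enough as long as it is not a root of unity:
      \<open>2 powi n = 1\<close> only for \<open>n = 0\<close>.\<close>
    have "lam 2 \<in> Sp6" using lam by (simp add: one_param_subgroup_def)
    then have "sympl_form v w = sympl_form (lam 2 *v v) (lam 2 *v w)"
      by (simp add: Sp6_sympl_form)
    also have "\<dots> = 2 powi (\<gamma> + \<beta>) * sympl_form v w"
      using v(1) that(2) by (simp add: weight_space_def sympl_form_linear power_int_add)
    finally have "sympl_form v w = 0 \<or> (2 :: complex) powi (\<gamma> + \<beta>) = 1" by simp
    moreover have "(2 :: complex) powi (\<gamma> + \<beta>) \<noteq> 1"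
    proof
      assume "(2 :: complex) powi (\<gamma> + \<beta>) = 1"
      then have "norm ((2 :: complex) powi (\<gamma> + \<beta>)) = 1" by simp
      then have "(2 :: real) powi (\<gamma> + \<beta>) = 1" by (simp add: norm_power_int)
      then have "\<gamma> + \<beta> = 0"
        using power_int_strict_increasing[of 0 "\<gamma> + \<beta>" "2 :: real"]
          power_int_strict_increasing[of "\<gamma> + \<beta>" 0 "2 :: real"]
        by (cases "\<gamma> + \<beta>" "0 :: int" rule: linorder_cases) simp_all
      then have "\<beta> = - \<gamma>" by simp
      with neg that show False by simp
    qed
    ultimately show ?thesis by simp
  qed
  have "sympl_form v w = 0" for w
    using sympl_form_span[of v "{v}" w "\<Union>\<beta>\<in>weights lam. weight_space lam \<beta>" "mat 1"]
      orth span_weight_spaces[OF lam]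
    by (auto simp: vec.span_base)
  then show False
    using sympl_form_nondegenerate v(2) by blast
qed

text \<open>Applying the isometry \<open>lam t\<close> to both arguments writes the constant
  \<open>sympl_form v (g *v w)\<close> as \<open>t powi (\<gamma> + \<beta>)\<close> times the
  pairing through the conjugate of \<open>g\<close>. For \<open>t\<close> tending to infinity the
  first factor tends to 0 and the second has a finite limit, by definition of the parabolic.\<close>

lemma parabolic_isotropic:
  assumes lam: "one_param_subgroup lam" and g: "g \<in> parabolic lam"
    and v: "v \<in> weight_space lam \<gamma>" and w: "w \<in> weight_space lam \<beta>" and neg: "\<gamma> + \<beta> < 0"
  shows "sympl_form v (g *v w) = 0"
proof -
  obtain h where h: "((\<lambda>t. lam t ** g ** matrix_inv (lam t)) \<longlongrightarrow> h) at_infinity"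
    using g by (auto simp: parabolic_def)
  have eq: "sympl_form v (g *v w)
      = t powi (\<gamma> + \<beta>) * sympl_form v ((lam t ** g ** matrix_inv (lam t)) *v w)"
    if t: "t \<noteq> 0" for t
  proof -
    have Sp: "lam t \<in> Sp6" using lam t by (simp add: one_param_subgroup_def)
    have "matrix_inv (lam t) ** lam t = mat 1"
      using Sp6_invertible[OF Sp] unfolding invertible_def matrix_inv_def
      by (metis (mono_tags, lifting) someI_ex)
    then have "lam t *v (g *v w) = (lam t ** g ** matrix_inv (lam t)) *v (lam t *v w)"
      by (metis matrix_mul_assoc matrix_mul_rid matrix_vector_mul_assoc)
    then have "sympl_form v (g *v w)
        = sympl_form (lam t *v v) ((lam t ** g ** matrix_inv (lam t)) *v (lam t *v w))"
      by (metis Sp Sp6_sympl_form)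
    also have "\<dots> = t powi (\<gamma> + \<beta>) * sympl_form v ((lam t ** g ** matrix_inv (lam t)) *v w)"
      using v w t
      by (simp add: weight_space_def sympl_form_linear vector_scalar_commute power_int_add)
    finally show ?thesis .
  qed
  have "((\<lambda>t. t powi (\<gamma> + \<beta>)) \<longlongrightarrow> (0 :: complex)) at_infinity"
  proof -
    have "((\<lambda>t. inverse t ^ nat (- (\<gamma> + \<beta>))) \<longlongrightarrow> (0 :: complex) ^ nat (- (\<gamma> + \<beta>))) at_infinity"
      by (intro tendsto_power tendsto_inverse_0)
    then show ?thesis
      using neg by (simp add: power_int_def zero_power)
  qed
  moreover have "((\<lambda>t. sympl_form v ((lam t ** g ** matrix_inv (lam t)) *v w))
      \<longlongrightarrow> sympl_form v (h *v w)) at_infinity"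
    unfolding sympl_form_def matrix_vector_mult_def
    by (simp, intro tendsto_intros h)
  ultimately have "((\<lambda>t. t powi (\<gamma> + \<beta>) * sympl_form v ((lam t ** g ** matrix_inv (lam t)) *v w))
      \<longlongrightarrow> 0 * sympl_form v (h *v w)) at_infinity"
    by (rule tendsto_mult)
  moreover have "\<forall>\<^sub>F t in at_infinity. t powi (\<gamma> + \<beta>) *
      sympl_form v ((lam t ** g ** matrix_inv (lam t)) *v w) = sympl_form v (g *v w)"
    using eventually_not_equal_at_infinity[of 0] by eventually_elim (simp add: eq)
  ultimately have "((\<lambda>t :: complex. sympl_form v (g *v w)) \<longlongrightarrow> 0 * sympl_form v (h *v w)) at_infinity"
    by (rule Lim_transform_eventually)
  then show ?thesis by (simp add: tendsto_const_iff trivial_limit_at_infinity)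
qed

lemma parabolic_flags_orthogonal:
  assumes lam: "one_param_subgroup lam" and g: "g \<in> parabolic lam"
    and weights: "sorted_list_of_set (weights lam) = [a, b, c]"
    and v: "v \<in> weight_flag lam a" and w: "w \<in> weight_flag lam b"
  shows "sympl_form v (g *v w) = 0"
proof -
  \<comment> \<open>\<open>sorted_list_of_set\<close> sends infinite sets to the empty list.\<close>
  have "finite (weights lam)"
    using weights sorted_list_of_set.fold_insort_key.infinite by fastforce
  then have set: "weights lam = {a, b, c}"
    using weights set_sorted_list_of_set by fastforce
  have "sorted_wrt (<) [a, b, c]"
    using weights strict_sorted_list_of_set[of "weights lam"] by metis
  then have "a < b" "b < c" by simp_all
  \<comment> \<open>If \<open>- c = a\<close>, then \<open>a + b = b - c < 0\<close>. If
    \<open>- c\<close> is \<open>b\<close> or \<open>c\<close>, then \<open>c \<ge> 0\<close> and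
    \<open>a < b < 0\<close>. So the symmetry at the largest weight already makes every sum of a
    weight up to \<open>a\<close> and one up to \<open>b\<close> negative.\<close>
  moreover have "- c \<in> {a, b, c}" using uminus_weight[OF lam, of c] set by simp
  ultimately have "a + b < 0" by auto
  show ?thesis
  proof (rule sympl_form_span[OF v[unfolded weight_flag_def] w[unfolded weight_flag_def]])
    fix v' w'
    assume "v' \<in> (\<Union>\<beta>\<in>{\<beta> \<in> weights lam. \<beta> \<le> a}. weight_space lam \<beta>)"
      and "w' \<in> (\<Union>\<beta>\<in>{\<beta> \<in> weights lam. \<beta> \<le> b}. weight_space lam \<beta>)"
    then show "sympl_form v' (g *v w') = 0"
      using parabolic_isotropic[OF lam g] \<open>a + b < 0\<close> by force
  qed
qed

section \<open>Local algebra of the bundle with its duality form\<close>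

lemma Op_subset: "W \<in> Op X U \<Longrightarrow> W \<subseteq> U"
  by (simp add: Op_def)

lemma Op_trans: "W \<in> Op X U \<Longrightarrow> U \<in> Op X U' \<Longrightarrow> W \<in> Op X U'"
  by (auto simp: Op_def)

lemma Op_refl: "U \<in> Op X U' \<Longrightarrow> U \<in> Op X U"
  by (simp add: Op_def)

lemma Op_Int: "W \<in> Op X U \<Longrightarrow> W' \<in> Op X U' \<Longrightarrow> W \<inter> W' \<in> Op X W \<and> W \<inter> W' \<in> Op X W'"
  by (auto simp: Op_def)

lemma structure_sheaf_simps [simp]:
  "Sec (structure_sheaf X) U = \<O> X U"
  "\<zero>\<^bsub>sect (structure_sheaf X) U\<^esub> = (\<lambda>x\<in>U. 0)"
  "f \<oplus>\<^bsub>sect (structure_sheaf X) U\<^esub> g = (\<lambda>x\<in>U. f x + g x)"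
  "f \<odot>\<^bsub>sect (structure_sheaf X) U\<^esub> g = (\<lambda>x\<in>U. f x * g x)"
  "rest (structure_sheaf X) U W f = restrict f W"
  by (simp_all add: structure_sheaf_def mk_module_def reg_ring_def)

lemma reg_ring_simps:
  "\<zero>\<^bsub>reg_ring X U\<^esub> = (\<lambda>x\<in>U. 0)"
  "\<one>\<^bsub>reg_ring X U\<^esub> = (\<lambda>x\<in>U. 1)"
  "f \<oplus>\<^bsub>reg_ring X U\<^esub> g = (\<lambda>x\<in>U. f x + g x)"
  "f \<otimes>\<^bsub>reg_ring X U\<^esub> g = (\<lambda>x\<in>U. f x * g x)"
  by (simp_all add: reg_ring_def)

lemma dual_sheaf_simps:
  "Sec (dual_sheaf X V) U = sheaf_homs X V (structure_sheaf X) U"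
  "\<zero>\<^bsub>sect (dual_sheaf X V) U\<^esub> = (\<lambda>W\<in>Op X U. \<lambda>a\<in>Sec V W. \<lambda>x\<in>W. 0)"
  "\<phi> \<oplus>\<^bsub>sect (dual_sheaf X V) U\<^esub> \<psi> = (\<lambda>W\<in>Op X U. \<lambda>a\<in>Sec V W. \<lambda>x\<in>W. \<phi> W a x + \<psi> W a x)"
  "f \<odot>\<^bsub>sect (dual_sheaf X V) U\<^esub> \<phi> = (\<lambda>W\<in>Op X U. \<lambda>a\<in>Sec V W. \<lambda>x\<in>W. f x * \<phi> W a x)"
  "rest (dual_sheaf X V) U W \<phi> = restrict \<phi> (Op X W)"
  by (simp_all add: hom_sheaf_def map_sheaf_def mk_module_def restrict_def cong: if_cong)

lemma with_dual_simps:
  "Sec (with_dual X V) U = Sec V U \<times> Sec (dual_sheaf X V) U"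
  "\<zero>\<^bsub>sect (with_dual X V) U\<^esub> = (\<zero>\<^bsub>sect V U\<^esub>, \<zero>\<^bsub>sect (dual_sheaf X V) U\<^esub>)"
  "s \<oplus>\<^bsub>sect (with_dual X V) U\<^esub> t =
     (fst s \<oplus>\<^bsub>sect V U\<^esub> fst t, snd s \<oplus>\<^bsub>sect (dual_sheaf X V) U\<^esub> snd t)"
  "f \<odot>\<^bsub>sect (with_dual X V) U\<^esub> s =
     (f \<odot>\<^bsub>sect V U\<^esub> fst s, f \<odot>\<^bsub>sect (dual_sheaf X V) U\<^esub> snd s)"
  "rest (with_dual X V) U W s = (rest V U W (fst s), rest (dual_sheaf X V) U W (snd s))"
  by (simp_all add: with_dual_def direct_sum_def mk_module_def split_beta)

lemma dual_homD:
  assumes "\<phi> \<in> sheaf_homs X V (structure_sheaf X) U" "W \<in> Op X U"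
  shows "a \<in> Sec V W \<Longrightarrow> \<phi> W a \<in> \<O> X W"
    and "a \<in> Sec V W \<Longrightarrow> W' \<in> Op X W \<Longrightarrow> \<phi> W' (rest V W W' a) = restrict (\<phi> W a) W'"
    and "a \<in> Sec V W \<Longrightarrow> b \<in> Sec V W \<Longrightarrow>
      \<phi> W (a \<oplus>\<^bsub>sect V W\<^esub> b) = (\<lambda>x\<in>W. \<phi> W a x + \<phi> W b x)"
    and "f \<in> \<O> X W \<Longrightarrow> a \<in> Sec V W \<Longrightarrow> \<phi> W (f \<odot>\<^bsub>sect V W\<^esub> a) = (\<lambda>x\<in>W. f x * \<phi> W a x)"
  using assms unfolding sheaf_homs_def nat_families_def
  by (auto simp: PiE_iff)

lemma dual_hom_eqI:
  assumes "\<phi> \<in> sheaf_homs X V (structure_sheaf X) U" "\<psi> \<in> sheaf_homs X V (structure_sheaf X) U"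
    and "\<And>W a. W \<in> Op X U \<Longrightarrow> a \<in> Sec V W \<Longrightarrow> \<phi> W a = \<psi> W a"
  shows "\<phi> = \<psi>"
proof (rule PiE_ext)
  show "\<phi> \<in> (\<Pi>\<^sub>E W\<in>Op X U. Sec V W \<rightarrow>\<^sub>E \<O> X W)" "\<psi> \<in> (\<Pi>\<^sub>E W\<in>Op X U. Sec V W \<rightarrow>\<^sub>E \<O> X W)"
    using assms(1,2) by (auto simp: sheaf_homs_def nat_families_def)
  then show "\<phi> W = \<psi> W" if "W \<in> Op X U" for W
    using that assms(3) by (intro PiE_ext[of _ "Sec V W" "\<lambda>_. \<O> X W"]) auto
qed

lemma restrict_regular:
  assumes f: "f \<in> \<O> X U" and W: "W \<in> Op X U"
  shows "restrict f W \<in> \<O> X W"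
proof -
  have "\<exists>W'\<in>Op X W. x \<in> W' \<and> (\<exists>d P Q. homogeneous d P \<and> homogeneous d Q \<and>
      (\<forall>y\<in>W'. \<forall>v\<in>y - {0}. Q v \<noteq> 0 \<and> restrict f W y = P v / Q v))" if x: "x \<in> W" for x
  proof -
    have "regular_fun X U f" using f by (simp add: reg_ring_def)
    moreover have "x \<in> U" using Op_subset[OF W] x by (rule subsetD)
    ultimately obtain W1 d P Q where W1: "W1 \<in> Op X U" "x \<in> W1"
      and PQ: "homogeneous d P" "homogeneous d Q"
        "\<forall>y\<in>W1. \<forall>v\<in>y - {0}. Q v \<noteq> 0 \<and> f y = P v / Q v"
      unfolding regular_fun_def by blast
    have "\<forall>y\<in>W1 \<inter> W. \<forall>v\<in>y - {0}. Q v \<noteq> 0 \<and> restrict f W y = P v / Q v"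
      using PQ(3) by (intro ballI) (elim IntE, simp)
    moreover have "W1 \<inter> W \<in> Op X W" "x \<in> W1 \<inter> W"
      using Op_Int[OF W1(1) W] W1(2) x by blast+
    ultimately show ?thesis using PQ(1,2) by blast
  qed
  then have "regular_fun X W (restrict f W)"
    unfolding regular_fun_def by (intro conjI ballI restrict_extensional)
  then show ?thesis by (simp add: reg_ring_def)
qed

section \<open>Sections of V, of its dual and of their direct sum as modules\<close>

locale module_sheaf =
  fixes X :: "'n::finite pt set" and V :: "('n pt, 'v) omodule"
  assumes sheaf: "sheaf_of_modules X V"
begin

abbreviation "B \<equiv> with_dual X V"

lemma module_sect: "U \<in> Op X X \<Longrightarrow> Module.module (reg_ring X U) (sect V U)"
  by (rule sheaf[unfolded sheaf_of_modules_def, THEN conjunct1, THEN bspec])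

text \<open>The ring axioms for regular functions are part of the module axioms for the sections of
  \<open>V\<close>, so closure under sums and products need not be derived from quotients of
  homogeneous polynomials.\<close>

lemma cring_reg_ring: "U \<in> Op X X \<Longrightarrow> cring (reg_ring X U)"
  by (drule module_sect) (rule Module.module.axioms(1))

lemma add_closed:
  assumes "U \<in> Op X X" "a \<in> Sec V U" "b \<in> Sec V U"
  shows "a \<oplus>\<^bsub>sect V U\<^esub> b \<in> Sec V U"
proof -
  interpret Module.module "reg_ring X U" "sect V U" using assms(1) by (rule module_sect)
  show ?thesis using assms by simp
qed

lemma smult_closed:
  assumes "U \<in> Op X X" "f \<in> \<O> X U" "a \<in> Sec V U"
  shows "f \<odot>\<^bsub>sect V U\<^esub> a \<in> Sec V U"
proof -
  interpret Module.module "reg_ring X U" "sect V U" using assms(1) by (rule module_sect)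
  show ?thesis using assms by simp
qed

lemmas rest_hom =
  sheaf[unfolded sheaf_of_modules_def, THEN conjunct2, THEN conjunct1, THEN bspec, THEN bspec]

lemma rest_closed: "U \<in> Op X X \<Longrightarrow> W \<in> Op X U \<Longrightarrow> s \<in> Sec V U \<Longrightarrow> rest V U W s \<in> Sec V W"
  by (rule rest_hom[THEN conjunct1, THEN funcset_mem])

lemma rest_add:
  "U \<in> Op X X \<Longrightarrow> W \<in> Op X U \<Longrightarrow> s \<in> Sec V U \<Longrightarrow> t \<in> Sec V U \<Longrightarrow>
     rest V U W (s \<oplus>\<^bsub>sect V U\<^esub> t) = rest V U W s \<oplus>\<^bsub>sect V W\<^esub> rest V U W t"
  by (rule rest_hom[THEN conjunct2, THEN conjunct1, THEN bspec, THEN bspec])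

lemma rest_smult:
  "U \<in> Op X X \<Longrightarrow> W \<in> Op X U \<Longrightarrow> f \<in> \<O> X U \<Longrightarrow> s \<in> Sec V U \<Longrightarrow>
     rest V U W (f \<odot>\<^bsub>sect V U\<^esub> s) = restrict f W \<odot>\<^bsub>sect V W\<^esub> rest V U W s"
  by (rule rest_hom[THEN conjunct2, THEN conjunct2, THEN bspec, THEN bspec])

lemma rest_rest:
  "U \<in> Op X X \<Longrightarrow> W \<in> Op X U \<Longrightarrow> W' \<in> Op X W \<Longrightarrow> s \<in> Sec V U \<Longrightarrow>
     rest V W W' (rest V U W s) = rest V U W' s"
  by (rule sheaf[unfolded sheaf_of_modules_def, THEN conjunct2, THEN conjunct2, THEN conjunct2,
        THEN conjunct1, THEN bspec, THEN bspec, THEN bspec, THEN bspec])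

lemma regular_add: "U \<in> Op X X \<Longrightarrow> f \<in> \<O> X U \<Longrightarrow> g \<in> \<O> X U \<Longrightarrow> (\<lambda>x\<in>U. f x + g x) \<in> \<O> X U"
  by (rule ring.ring_simprules(1)[OF cring.axioms(1)[OF cring_reg_ring], unfolded reg_ring_simps])

lemma regular_mult: "U \<in> Op X X \<Longrightarrow> f \<in> \<O> X U \<Longrightarrow> g \<in> \<O> X U \<Longrightarrow> (\<lambda>x\<in>U. f x * g x) \<in> \<O> X U"
  by (rule ring.ring_simprules(5)[OF cring.axioms(1)[OF cring_reg_ring], unfolded reg_ring_simps])

lemma regular_mult_restrict:
  assumes "f \<in> \<O> X U" "U \<in> Op X X" "W \<in> Op X U" "g \<in> \<O> X W"
  shows "(\<lambda>x\<in>W. f x * g x) \<in> \<O> X W"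
  using regular_mult[OF Op_trans[OF assms(3,2)] restrict_regular[OF assms(1,3)] assms(4)]
  by (simp add: restrict_def cong: if_cong)

lemma regular_zero: "U \<in> Op X X \<Longrightarrow> (\<lambda>x\<in>U. 0) \<in> \<O> X U"
  by (rule ring.ring_simprules(2)[OF cring.axioms(1)[OF cring_reg_ring], unfolded reg_ring_simps])

lemma regular_one: "U \<in> Op X X \<Longrightarrow> (\<lambda>x\<in>U. 1) \<in> \<O> X U"
  by (rule ring.ring_simprules(6)[OF cring.axioms(1)[OF cring_reg_ring], unfolded reg_ring_simps])

text \<open>Zero, sums and multiples in the dual sheaf are all given by formulas for the value at a
  section and a point. This criterion handles the nested restrictions once, leaving only conditions
  on values.\<close>

lemma dual_hom_pointwise:
  assumes U: "U \<in> Op X X"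
    and reg: "\<And>W a. W \<in> Op X U \<Longrightarrow> a \<in> Sec V W \<Longrightarrow> (\<lambda>x\<in>W. F W a x) \<in> \<O> X W"
    and nat: "\<And>W W' a x. W \<in> Op X U \<Longrightarrow> W' \<in> Op X W \<Longrightarrow> a \<in> Sec V W \<Longrightarrow> x \<in> W' \<Longrightarrow>
      F W' (rest V W W' a) x = F W a x"
    and add: "\<And>W a b x. W \<in> Op X U \<Longrightarrow> a \<in> Sec V W \<Longrightarrow> b \<in> Sec V W \<Longrightarrow> x \<in> W \<Longrightarrow>
      F W (a \<oplus>\<^bsub>sect V W\<^esub> b) x = F W a x + F W b x"
    and smult: "\<And>W a f x. W \<in> Op X U \<Longrightarrow> a \<in> Sec V W \<Longrightarrow> f \<in> \<O> X W \<Longrightarrow> x \<in> W \<Longrightarrow>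
      F W (f \<odot>\<^bsub>sect V W\<^esub> a) x = f x * F W a x"
  shows "(\<lambda>W\<in>Op X U. \<lambda>a\<in>Sec V W. \<lambda>x\<in>W. F W a x) \<in> sheaf_homs X V (structure_sheaf X) U"
proof -
  have O: "W \<in> Op X X" if "W \<in> Op X U" for W
    using that U by (rule Op_trans)
  show ?thesis
    unfolding sheaf_homs_def nat_families_def
  proof (intro CollectI conjI ballI)
    show "(\<lambda>W\<in>Op X U. \<lambda>a\<in>Sec V W. \<lambda>x\<in>W. F W a x)
        \<in> (\<Pi>\<^sub>E W\<in>Op X U. Sec V W \<rightarrow>\<^sub>E Sec (structure_sheaf X) W)"
      using reg by (auto simp: PiE_iff)
  next
    fix W W' a assume *: "W \<in> Op X U" "W' \<in> Op X W" "a \<in> Sec V W"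
    then have "W' \<in> Op X U" "W' \<subseteq> W" by (auto simp: Op_def)
    with * show "(\<lambda>W\<in>Op X U. \<lambda>a\<in>Sec V W. \<lambda>x\<in>W. F W a x) W' (rest V W W' a) =
        rest (structure_sheaf X) W W' ((\<lambda>W\<in>Op X U. \<lambda>a\<in>Sec V W. \<lambda>x\<in>W. F W a x) W a)"
      using rest_closed[OF O[OF *(1)] *(2,3)] nat
      by (auto simp: fun_eq_iff restrict_def)
  qed (auto simp: fun_eq_iff restrict_def add smult add_closed smult_closed O)
qed

lemma dual_add_closed:
  assumes U: "U \<in> Op X X" and "\<phi> \<in> Sec (dual_sheaf X V) U" "\<psi> \<in> Sec (dual_sheaf X V) U"
  shows "\<phi> \<oplus>\<^bsub>sect (dual_sheaf X V) U\<^esub> \<psi> \<in> Sec (dual_sheaf X V) U"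
  using assms(2,3) unfolding dual_sheaf_simps
  by (intro dual_hom_pointwise[OF U])
     (auto simp: dual_homD regular_add Op_trans[OF _ U] algebra_simps dest: subsetD[OF Op_subset])

lemma dual_smult_closed:
  assumes U: "U \<in> Op X X" and "f \<in> \<O> X U" "\<phi> \<in> Sec (dual_sheaf X V) U"
  shows "f \<odot>\<^bsub>sect (dual_sheaf X V) U\<^esub> \<phi> \<in> Sec (dual_sheaf X V) U"
  using assms(2,3) unfolding dual_sheaf_simps
  by (intro dual_hom_pointwise[OF U])
     (auto simp: dual_homD regular_mult_restrict[OF _ U] Op_trans[OF _ U] algebra_simps
       dest: subsetD[OF Op_subset])

lemma dual_zero_closed:
  assumes U: "U \<in> Op X X"
  shows "\<zero>\<^bsub>sect (dual_sheaf X V) U\<^esub> \<in> Sec (dual_sheaf X V) U"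
  unfolding dual_sheaf_simps
  by (intro dual_hom_pointwise[OF U]) (auto simp: regular_zero Op_trans[OF _ U])

lemma dual_rest_closed:
  assumes W: "W \<in> Op X U" and "\<phi> \<in> Sec (dual_sheaf X V) U"
  shows "rest (dual_sheaf X V) U W \<phi> \<in> Sec (dual_sheaf X V) W"
proof -
  have \<phi>: "\<phi> \<in> sheaf_homs X V (structure_sheaf X) U"
    using assms(2) by (simp only: dual_sheaf_simps)
  have U: "W' \<in> Op X U" if "W' \<in> Op X W" for W'
    using that W by (rule Op_trans)
  have "restrict \<phi> (Op X W) \<in> sheaf_homs X V (structure_sheaf X) W"
    unfolding sheaf_homs_def nat_families_def
  proof (intro CollectI conjI ballI)
    have "\<phi> \<in> (\<Pi>\<^sub>E W'\<in>Op X U. Sec V W' \<rightarrow>\<^sub>E Sec (structure_sheaf X) W')"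
      using \<phi> by (simp add: sheaf_homs_def nat_families_def)
    then show "restrict \<phi> (Op X W) \<in> (\<Pi>\<^sub>E W'\<in>Op X W. Sec V W' \<rightarrow>\<^sub>E Sec (structure_sheaf X) W')"
      unfolding restrict_PiE_iff using U by (blast intro: PiE_mem)
  next
    fix W1 W2 a assume *: "W1 \<in> Op X W" "W2 \<in> Op X W1" "a \<in> Sec V W1"
    then have "W2 \<in> Op X W" by (blast intro: Op_trans)
    with * show "restrict \<phi> (Op X W) W2 (rest V W1 W2 a) =
        rest (structure_sheaf X) W1 W2 (restrict \<phi> (Op X W) W1 a)"
      by (simp add: dual_homD(2)[OF \<phi> U[OF *(1)]])
  qed (simp_all add: dual_homD[OF \<phi> U])
  then show ?thesis by (simp only: dual_sheaf_simps)
qed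

text \<open>\<open>lin_comb\<close> is a \<open>finsum\<close>, whose recursion rules require an
  abelian monoid; this supplies the dual summand.\<close>

lemma abelian_monoid_dual:
  assumes U: "U \<in> Op X X"
  shows "abelian_monoid (sect (dual_sheaf X V) U)"
proof (rule abelian_monoidI)
  fix \<phi> \<psi> \<theta>
  assume *: "\<phi> \<in> Sec (dual_sheaf X V) U" "\<psi> \<in> Sec (dual_sheaf X V) U" "\<theta> \<in> Sec (dual_sheaf X V) U"
  show "(\<phi> \<oplus>\<^bsub>sect (dual_sheaf X V) U\<^esub> \<psi>) \<oplus>\<^bsub>sect (dual_sheaf X V) U\<^esub> \<theta> =
      \<phi> \<oplus>\<^bsub>sect (dual_sheaf X V) U\<^esub> (\<psi> \<oplus>\<^bsub>sect (dual_sheaf X V) U\<^esub> \<theta>)"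
    unfolding dual_sheaf_simps by (auto simp: fun_eq_iff restrict_def add.assoc)
next
  fix \<phi> assume \<phi>: "\<phi> \<in> Sec (dual_sheaf X V) U"
  show "\<zero>\<^bsub>sect (dual_sheaf X V) U\<^esub> \<oplus>\<^bsub>sect (dual_sheaf X V) U\<^esub> \<phi> = \<phi>"
  proof (rule dual_hom_eqI)
    show "\<zero>\<^bsub>sect (dual_sheaf X V) U\<^esub> \<oplus>\<^bsub>sect (dual_sheaf X V) U\<^esub> \<phi>
        \<in> sheaf_homs X V (structure_sheaf X) U"
      using dual_add_closed[OF U dual_zero_closed[OF U] \<phi>] by (simp only: dual_sheaf_simps)
    show "\<phi> \<in> sheaf_homs X V (structure_sheaf X) U"
      using \<phi> by (simp only: dual_sheaf_simps)
    fix W a assume "W \<in> Op X U" "a \<in> Sec V W"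
    \<comment> \<open>Addition cuts its result down to \<open>W\<close>, so the neutral law needs
      \<open>\<phi> W a\<close> to be undefined outside \<open>W\<close> already.\<close>
    moreover from this have "\<phi> W a \<in> extensional W"
      using \<phi> dual_homD(1)[of \<phi>] by (auto simp: dual_sheaf_simps reg_ring_def regular_fun_def)
    ultimately show "(\<zero>\<^bsub>sect (dual_sheaf X V) U\<^esub> \<oplus>\<^bsub>sect (dual_sheaf X V) U\<^esub> \<phi>) W a = \<phi> W a"
      by (auto simp: dual_sheaf_simps fun_eq_iff extensional_def)
  qed
next
  fix \<phi> \<psi>
  show "\<phi> \<oplus>\<^bsub>sect (dual_sheaf X V) U\<^esub> \<psi> = \<psi> \<oplus>\<^bsub>sect (dual_sheaf X V) U\<^esub> \<phi>"
    unfolding dual_sheaf_simps by (simp add: add.commute)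
qed (use dual_add_closed[OF U] dual_zero_closed[OF U] in auto)

lemma abelian_monoid_with_dual:
  assumes U: "U \<in> Op X X"
  shows "abelian_monoid (sect B U)"
proof -
  interpret V: Module.module "reg_ring X U" "sect V U" using module_sect[OF U] .
  interpret D: abelian_monoid "sect (dual_sheaf X V) U" using abelian_monoid_dual[OF U] .
  show ?thesis
    by (rule abelian_monoidI) (auto simp: with_dual_simps V.M.a_ac D.a_ac)
qed

lemma with_dual_smult_closed:
  assumes U: "U \<in> Op X X" and "f \<in> \<O> X U" "s \<in> Sec B U"
  shows "f \<odot>\<^bsub>sect B U\<^esub> s \<in> Sec B U"
proof -
  interpret V: Module.module "reg_ring X U" "sect V U" using module_sect[OF U] .
  show ?thesis
    using assms dual_smult_closed[OF U] by (auto simp: with_dual_simps)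
qed

lemma with_dual_rest_closed:
  assumes "U \<in> Op X X" "W \<in> Op X U" "s \<in> Sec B U"
  shows "rest B U W s \<in> Sec B W"
  using assms rest_closed dual_rest_closed by (auto simp: with_dual_simps)

lemma with_dual_rest_rest:
  assumes U: "U \<in> Op X X" and W: "W \<in> Op X U" and W': "W' \<in> Op X W" and s: "s \<in> Sec B U"
  shows "rest B W W' (rest B U W s) = rest B U W' s"
proof -
  have "Op X W \<inter> Op X W' = Op X W'" using Op_trans[OF _ W'] by blast
  moreover have "rest V W W' (rest V U W (fst s)) = rest V U W' (fst s)"
    using s by (intro rest_rest[OF U W W']) (auto simp: with_dual_simps)
  ultimately show ?thesis
    by (simp add: with_dual_simps dual_sheaf_simps restrict_restrict)
qed

lemma dual_rest_add:
  assumes W: "W \<in> Op X U"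
  shows "rest (dual_sheaf X V) U W (\<phi> \<oplus>\<^bsub>sect (dual_sheaf X V) U\<^esub> \<psi>) =
    rest (dual_sheaf X V) U W \<phi> \<oplus>\<^bsub>sect (dual_sheaf X V) W\<^esub> rest (dual_sheaf X V) U W \<psi>"
  unfolding dual_sheaf_simps by (intro ext) (simp add: Op_trans[OF _ W])

lemma dual_rest_smult:
  assumes W: "W \<in> Op X U"
  shows "rest (dual_sheaf X V) U W (f \<odot>\<^bsub>sect (dual_sheaf X V) U\<^esub> \<phi>) =
    restrict f W \<odot>\<^bsub>sect (dual_sheaf X V) W\<^esub> rest (dual_sheaf X V) U W \<phi>"
  unfolding dual_sheaf_simps
  by (intro ext) (auto simp: Op_trans[OF _ W] dest: subsetD[OF Op_subset])

lemma with_dual_rest_add: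
  assumes "U \<in> Op X X" "W \<in> Op X U" "s \<in> Sec B U" "t \<in> Sec B U"
  shows "rest B U W (s \<oplus>\<^bsub>sect B U\<^esub> t) = rest B U W s \<oplus>\<^bsub>sect B W\<^esub> rest B U W t"
  using assms(3,4) rest_add[OF assms(1,2)] dual_rest_add[OF assms(2)]
  by (auto simp only: with_dual_simps fst_conv snd_conv mem_Times_iff)

lemma with_dual_rest_smult:
  assumes "U \<in> Op X X" "W \<in> Op X U" "f \<in> \<O> X U" "s \<in> Sec B U"
  shows "rest B U W (f \<odot>\<^bsub>sect B U\<^esub> s) = restrict f W \<odot>\<^bsub>sect B W\<^esub> rest B U W s"
  using assms(3,4) rest_smult[OF assms(1,2)] dual_rest_smult[OF assms(2)]
  by (auto simp only: with_dual_simps fst_conv snd_conv mem_Times_iff)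

section \<open>The duality form on linear combinations and under restriction\<close>

lemma duality_form_add:
  assumes U: "U \<in> Op X X" and x: "x \<in> U" and "s \<in> Sec B U" "s' \<in> Sec B U" "t \<in> Sec B U"
  shows "duality_form U (s \<oplus>\<^bsub>sect B U\<^esub> s') t x = duality_form U s t x + duality_form U s' t x"
    and "duality_form U t (s \<oplus>\<^bsub>sect B U\<^esub> s') x = duality_form U t s x + duality_form U t s' x"
  using assms dual_homD(3)[OF _ Op_refl[OF U], of _ V] Op_refl[OF U]
  by (auto simp: duality_form_def with_dual_simps dual_sheaf_simps split_beta algebra_simps)

lemma duality_form_smult:
  assumes U: "U \<in> Op X X" and x: "x \<in> U" and "f \<in> \<O> X U" "s \<in> Sec B U" "t \<in> Sec B U"
  shows "duality_form U (f \<odot>\<^bsub>sect B U\<^esub> s) t x = f x * duality_form U s t x"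
    and "duality_form U t (f \<odot>\<^bsub>sect B U\<^esub> s) x = f x * duality_form U t s x"
  using assms dual_homD(4)[OF _ Op_refl[OF U], of _ V] Op_refl[OF U]
  by (auto simp: duality_form_def with_dual_simps dual_sheaf_simps split_beta algebra_simps)

text \<open>Here \<open>h\<close> stands for the duality form at the point \<open>x\<close> with one
  argument fixed, possibly after restricting the other to a smaller open set. Leaving
  \<open>h\<close> abstract lets the same lemma expand either argument.\<close>

lemma lin_comb_eval:
  assumes U: "U \<in> Op X X"
    and "finite I" "\<And>k. k \<in> I \<Longrightarrow> f k \<in> \<O> X U" "\<And>k. k \<in> I \<Longrightarrow> e k \<in> Sec B U"
    and add: "\<And>s t. s \<in> Sec B U \<Longrightarrow> t \<in> Sec B U \<Longrightarrow> h (s \<oplus>\<^bsub>sect B U\<^esub> t) = h s + h t"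
    and smult: "\<And>f s. f \<in> \<O> X U \<Longrightarrow> s \<in> Sec B U \<Longrightarrow> h (f \<odot>\<^bsub>sect B U\<^esub> s) = f x * h s"
  shows "h (lin_comb B U I f e) = (\<Sum>k\<in>I. f k x * (h (e k) :: complex))"
proof -
  interpret abelian_monoid "sect B U" using abelian_monoid_with_dual[OF U] .
  have "h \<zero>\<^bsub>sect B U\<^esub> = 0" using add[of "\<zero>\<^bsub>sect B U\<^esub>" "\<zero>\<^bsub>sect B U\<^esub>"] by simp
  moreover have "h (finsum (sect B U) s I) = (\<Sum>k\<in>I. h (s k))"
    if "s \<in> I \<rightarrow> Sec B U" for s
    using \<open>finite I\<close> that
    by (induction I rule: finite_induct) (use calculation add in \<open>auto simp: Pi_iff\<close>)
  ultimately show ?thesis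
    using assms(3,4) by (simp add: lin_comb_def smult with_dual_smult_closed[OF U])
qed

lemma duality_form_rest:
  assumes U: "U \<in> Op X X" and W: "W \<in> Op X U" and x: "x \<in> W"
    and "s \<in> Sec B U" "t \<in> Sec B U"
  shows "duality_form W (rest B U W s) (rest B U W t) x = duality_form U s t x"
proof -
  have "x \<in> U" using W x by (auto dest: Op_subset)
  then show ?thesis
    using assms(3-5) dual_homD(2)[OF _ Op_refl[OF U] _ W, of _ V] Op_refl[OF W]
    by (auto simp: duality_form_def with_dual_simps dual_sheaf_simps split_beta)
qed

text \<open>With coordinate vectors \<open>w\<close>, \<open>w'\<close> in frames \<open>e\<close>,
  \<open>e'\<close> and a transition matrix \<open>g\<close> between the frames, the pairing at
  \<open>x\<close> equals \<open>sympl_form (w x) (g x *v w' x)\<close>. The hypothesis on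
  \<open>P\<close>, \<open>Y\<close> and \<open>Y'\<close> is exactly what kills this
  number.\<close>

lemma reduction_sections_orthogonal:
  assumes red: "reduction X B (symplectic_frames X B duality_form) U P R"
    and orth: "\<And>g v w. g \<in> P \<Longrightarrow> v \<in> Y \<Longrightarrow> w \<in> Y' \<Longrightarrow> sympl_form v (g *v w) = 0"
    and U: "U \<in> Op X X" and W: "W \<in> Op X U" and x: "x \<in> W"
    and s: "s \<in> associated_sub X B R Y W" and s': "s' \<in> associated_sub X B R Y' W"
  shows "duality_form W s s' x = 0"
proof -
  have red': "R W \<subseteq> symplectic_frames X B duality_form W"
    "\<And>e W'. e \<in> R W \<Longrightarrow> W' \<in> Op X W \<Longrightarrow> rest B W W' \<circ> e \<in> R W'"
    "\<And>e e'. e \<in> R W \<Longrightarrow> e' \<in> R W \<Longrightarrow> \<exists>g\<in>regular_maps X W P. e' = frame_act B W e g"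
    if "W \<in> Op X U" for W
    using conjunct1[OF red[unfolded reduction_def], THEN bspec, OF that] by simp_all
  have W_X: "W \<in> Op X X" using W U by (rule Op_trans)
  obtain W1 e w where W1: "W1 \<in> Op X W" "x \<in> W1" "e \<in> R W1" "\<forall>y\<in>W1. w y \<in> Y"
    "\<forall>k. (\<lambda>y\<in>W1. w y $ k) \<in> \<O> X W1"
    "rest B W W1 s = lin_comb B W1 UNIV (\<lambda>k. \<lambda>y\<in>W1. w y $ k) e"
    using s x unfolding associated_sub_def by blast
  obtain W2 e' w' where W2: "W2 \<in> Op X W" "x \<in> W2" "e' \<in> R W2" "\<forall>y\<in>W2. w' y \<in> Y'"
    "\<forall>k. (\<lambda>y\<in>W2. w' y $ k) \<in> \<O> X W2"
    "rest B W W2 s' = lin_comb B W2 UNIV (\<lambda>k. \<lambda>y\<in>W2. w' y $ k) e'"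
    using s' x unfolding associated_sub_def by blast
  \<comment> \<open>The two expansions live on different neighbourhoods of \<open>x\<close>; the
    frames can be compared only on the overlap.\<close>
  define W3 where "W3 = W1 \<inter> W2"
  have W3: "W3 \<in> Op X W1" "W3 \<in> Op X W2" "x \<in> W3"
    using Op_Int[OF W1(1) W2(1)] W1(2) W2(2) by (simp_all add: W3_def)
  have W3_W: "W3 \<in> Op X W" using W3(1) W1(1) by (rule Op_trans)
  note U_W = Op_trans[OF _ W] and X_W = Op_trans[OF _ W_X]
  have frame: "e k \<in> Sec B W" "x \<in> W \<Longrightarrow> duality_form W (e k) (e l) x = sympl_J $ k $ l"
    if "W \<in> Op X U" "e \<in> R W" for W e k l
    using subsetD[OF red'(1)[OF that(1)] that(2)] Op_trans[OF that(1) U]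
    by (auto simp: symplectic_frames_def basis_on_def)
  note e = frame(1)[OF U_W[OF W1(1)] W1(3)] and e' = frame(1)[OF U_W[OF W2(1)] W2(3)]
  have e3: "rest B W1 W3 \<circ> e \<in> R W3" and e3': "rest B W2 W3 \<circ> e' \<in> R W3"
    using red'(2) U_W W1 W2 W3 by blast+
  note e3_Sec = frame(1)[OF U_W[OF W3_W] e3] and e3'_Sec = frame(1)[OF U_W[OF W3_W] e3']
  obtain g where g: "g \<in> regular_maps X W3 P" "rest B W2 W3 \<circ> e' = frame_act B W3 (rest B W1 W3 \<circ> e) g"
    using red'(3)[OF U_W[OF W3_W] e3 e3'] by blast
  \<comment> \<open>This is the entry (k, l) of \<open>sympl_J ** g x\<close>: expand the second
    frame in the first, which is symplectic.\<close>
  have pairing: "duality_form W3 (rest B W1 W3 (e k)) (rest B W2 W3 (e' l)) x =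
      (\<Sum>m\<in>UNIV. g x $ m $ l * sympl_J $ k $ m)" for k l
  proof -
    have "rest B W2 W3 (e' l) =
        lin_comb B W3 UNIV (\<lambda>m. \<lambda>x\<in>W3. g x $ m $ l) (rest B W1 W3 \<circ> e)"
      using fun_cong[OF g(2), of l] by (simp add: frame_act_def)
    also have "duality_form W3 (rest B W1 W3 (e k)) \<dots> x =
        (\<Sum>m\<in>UNIV. (\<lambda>x\<in>W3. g x $ m $ l) x *
           duality_form W3 (rest B W1 W3 (e k)) ((rest B W1 W3 \<circ> e) m) x)"
      using g(1) e3_Sec[of k]
      by (intro lin_comb_eval[OF X_W[OF W3_W], where h = "\<lambda>t. duality_form W3 (rest B W1 W3 (e k)) t x"] e3_Sec
          duality_form_add duality_form_smult X_W[OF W3_W] W3(3))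
        (simp_all add: regular_maps_def)
    finally show ?thesis
      using W3(3) frame(2)[OF U_W[OF W3_W] e3 W3(3)] by simp
  qed
  \<comment> \<open>The expansion of \<open>s'\<close> stays over \<open>W2\<close>; restriction to
    \<open>W3\<close> is absorbed into \<open>h\<close>, so no linear combination has to be
    restricted explicitly.\<close>
  have pairing': "duality_form W3 (rest B W1 W3 (e k)) (rest B W2 W3 (rest B W W2 s')) x =
      (\<Sum>l\<in>UNIV. w' x $ l * (\<Sum>m\<in>UNIV. g x $ m $ l * sympl_J $ k $ m))" for k
  proof -
    have "duality_form W3 (rest B W1 W3 (e k)) (rest B W2 W3 (rest B W W2 s')) x =
        (\<Sum>l\<in>UNIV. (\<lambda>y\<in>W2. w' y $ l) x * duality_form W3 (rest B W1 W3 (e k)) (rest B W2 W3 (e' l)) x)"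
      unfolding W2(6) using W2(5) e3_Sec[of k] W3(2,3)
      by (intro lin_comb_eval[OF X_W[OF W2(1)],
            where h = "\<lambda>t. duality_form W3 (rest B W1 W3 (e k)) (rest B W2 W3 t) x"] e')
        (simp_all add: with_dual_rest_add[OF X_W[OF W2(1)] W3(2)]
          with_dual_rest_smult[OF X_W[OF W2(1)] W3(2)] with_dual_rest_closed[OF X_W[OF W2(1)] W3(2)]
          duality_form_add[OF X_W[OF W3_W]] duality_form_smult[OF X_W[OF W3_W]]
          restrict_regular[OF _ W3(2)])
    then show ?thesis using W2(2) by (simp add: pairing)
  qed
  have s_Sec: "s \<in> Sec B W" "s' \<in> Sec B W"
    using s s' by (simp_all add: associated_sub_def)
  have "duality_form W s s' x = duality_form W3 (rest B W W3 s) (rest B W W3 s') x"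
    using s_Sec by (simp add: duality_form_rest[OF W_X W3_W W3(3)])
  also have "\<dots> = duality_form W3 (rest B W1 W3 (rest B W W1 s)) (rest B W2 W3 (rest B W W2 s')) x"
    using s_Sec by (simp add: with_dual_rest_rest[OF W_X W1(1) W3(1)]
        with_dual_rest_rest[OF W_X W2(1) W3(2)])
  also have "\<dots> = (\<Sum>k\<in>UNIV. (\<lambda>y\<in>W1. w y $ k) x *
      duality_form W3 (rest B W1 W3 (e k)) (rest B W2 W3 (rest B W W2 s')) x)"
  proof -
    have "rest B W2 W3 (rest B W W2 s') \<in> Sec B W3"
      using s_Sec(2) by (intro with_dual_rest_closed[OF X_W[OF W2(1)] W3(2)]
          with_dual_rest_closed[OF W_X W2(1)])
    then show ?thesis
      unfolding W1(6) using W1(5) W3(1,3)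
      by (intro lin_comb_eval[OF X_W[OF W1(1)],
            where h = "\<lambda>t. duality_form W3 (rest B W1 W3 t) (rest B W2 W3 (rest B W W2 s')) x"] e)
        (simp_all add: with_dual_rest_add[OF X_W[OF W1(1)] W3(1)]
          with_dual_rest_smult[OF X_W[OF W1(1)] W3(1)] with_dual_rest_closed[OF X_W[OF W1(1)] W3(1)]
          duality_form_add[OF X_W[OF W3_W]] duality_form_smult[OF X_W[OF W3_W]]
          restrict_regular[OF _ W3(1)])
  qed
  also have "\<dots> = sympl_form (w x) (g x *v w' x)"
  proof -
    have "(\<Sum>l\<in>UNIV. w' x $ l * (\<Sum>m\<in>UNIV. g x $ m $ l * sympl_J $ k $ m)) =
        (sympl_J *v (g x *v w' x)) $ k" for k
    proof -
      have "(\<Sum>l\<in>UNIV. w' x $ l * (\<Sum>m\<in>UNIV. g x $ m $ l * sympl_J $ k $ m)) =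
          (\<Sum>l\<in>UNIV. \<Sum>m\<in>UNIV. sympl_J $ k $ m * (g x $ m $ l * w' x $ l))"
        by (simp add: sum_distrib_left mult_ac)
      also have "\<dots> = (\<Sum>m\<in>UNIV. \<Sum>l\<in>UNIV. sympl_J $ k $ m * (g x $ m $ l * w' x $ l))"
        by (rule sum.swap)
      finally show ?thesis
        by (simp add: matrix_vector_mult_def sum_distrib_left)
    qed
    then show ?thesis using W1(2) by (simp add: pairing' sympl_form_def)
  qed
  also have "\<dots> = 0"
    using g(1) W1(2,4) W2(2,4) W3(3) by (intro orth) (auto simp: regular_maps_def)
  finally show ?thesis .
qed

text \<open>Surjectivity of \<open>p\<close> as a sheaf map is only local, so a preimage of the
  constant 1 is available after shrinking \<open>U\<close> around \<open>x\<close>.\<close>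

lemma claimed_filtration_not_orthogonal:
  assumes p: "p \<in> sheaf_homs X V (structure_sheaf X) X"
    and U: "U \<in> Op X X" and x: "x \<in> U"
    and surj: "\<And>b. b \<in> \<O> X U \<Longrightarrow> \<exists>W\<in>Op X U. x \<in> W \<and> restrict b W \<in> p W ` Sec V W"
  obtains W s t where "W \<in> Op X U" "x \<in> W"
    "s \<in> (claimed_filtration X V p ! 0) W" "t \<in> (claimed_filtration X V p ! 1) W"
    "s \<in> Sec B W" "t \<in> Sec B W" "duality_form W s t x \<noteq> 0"
proof -
  obtain W v where W: "W \<in> Op X U" "x \<in> W" and v: "v \<in> Sec V W"
    and "restrict (\<lambda>y\<in>U. 1) W = p W v"
    using surj[OF regular_one[OF U]] by blast
  then have pv: "p W v = (\<lambda>y\<in>W. 1)"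
    using Op_subset[OF W(1)] by (metis restrict_restrict inf.absorb_iff2)
  have W_X: "W \<in> Op X X" using W(1) U by (rule Op_trans)
  define q where "q = (\<lambda>h. h \<odot>\<^bsub>sect (dual_sheaf X V) W\<^esub> restrict p (Op X W))"
  have pW: "restrict p (Op X W) \<in> Sec (dual_sheaf X V) W"
    using dual_rest_closed[OF W_X, of p] p by (simp add: dual_sheaf_simps)
  have q: "q h \<in> dual_image X V p W" "q h \<in> Sec (dual_sheaf X V) W" if "h \<in> \<O> X W" for h
    using that pW dual_smult_closed[OF W_X] by (auto simp: q_def dual_image_def)
  interpret Module.module "reg_ring X W" "sect V W" using W_X by (rule module_sect)
  \<comment> \<open>Both dual components are written as multiples of \<open>p\<close>, by 1 and by
    0, since this is how \<open>dual_image\<close> presents its elements.\<close>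
  let ?s = "(\<zero>\<^bsub>sect V W\<^esub>, q (\<lambda>y\<in>W. 1))" and ?t = "(v, q (\<lambda>y\<in>W. 0))"
  have "duality_form W ?s ?t x \<noteq> 0"
    using v W(2) Op_refl[OF W_X] pv
    by (simp add: duality_form_def q_def dual_sheaf_simps)
  with q[OF regular_one[OF W_X]] q[OF regular_zero[OF W_X]] v W W_X show ?thesis
    by (intro that[of W ?s ?t]) (simp_all add: claimed_filtration_def with_dual_simps)
qed

end

text \<open>If \<open>U\<close> were empty, its complement would be the irreducible space
  \<open>X\<close>. No irreducible closed set is strictly larger, so chains starting at
  \<open>X\<close> have length 0 and the codimension would be 0 instead of at least 2.\<close>

lemma big_open_nonempty:
  assumes irr: "irreducible_closed (zariski X) X" and big: "big_open X U"
  shows "U \<noteq> {}"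
proof
  assume "U = {}"
  then have "2 \<le> codim (zariski X) X"
    using big by (simp add: big_open_def)
  also have "\<dots> \<le> Sup {enat k | k. \<exists>c. irreducible_chain (zariski X) k c \<and> c 0 = X}"
    unfolding codim_def using irr by (intro Inf_lower) blast
  also have "\<dots> \<le> 0"
  proof (rule Sup_least)
    fix n assume "n \<in> {enat k | k. \<exists>c. irreducible_chain (zariski X) k c \<and> c 0 = X}"
    then obtain k c where n: "n = enat k" and c: "irreducible_chain (zariski X) k c" "c 0 = X"
      by blast
    have "k = 0"
    proof (rule ccontr)
      assume "k \<noteq> 0"
      then have "c 0 \<subset> c (Suc 0)" "irreducible_closed (zariski X) (c (Suc 0))"
        using c(1) by (simp_all add: irreducible_chain_def)
      moreover from this have "c (Suc 0) \<subseteq> X"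
        using closedin_subset by (fastforce simp: irreducible_closed_def)
      ultimately show False using c(2) by blast
    qed
    then show "n \<le> 0" by (simp add: n zero_enat_def)
  qed
  finally show False by simp
qed

theorem mainTheorem6:
  fixes X :: "'n::finite pt set"
    and L :: "('n pt, 'l) omodule"
    and V :: "('n pt, 'v) omodule"
    and j :: "'n pt set \<Rightarrow> ('n pt set \<Rightarrow> ('n pt \<Rightarrow> complex) \<Rightarrow> 'n pt \<Rightarrow> complex) \<Rightarrow> 'v"
    and p :: "'n pt set \<Rightarrow> 'v \<Rightarrow> 'n pt \<Rightarrow> complex"
  assumes K3: "K3_surface X"
    and polarization: "ample X L"
    and V: "sheaf_of_modules X V"
    and extension: "short_exact X (tangent_sheaf X) V (structure_sheaf X) j p"
    and nonsplit: "\<not> split_epi X V (structure_sheaf X) p"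
    and B: "B = with_dual X V"
    and E: "E = symplectic_frames X B duality_form"
  shows "\<not> corresponds_to_parabolic_reduction X B E (claimed_filtration X V p) \<and>
         ((\<forall>Fs. is_gieseker_HN_filtration X L B Fs \<longleftrightarrow> Fs = claimed_filtration X V p) \<longrightarrow>
          (\<forall>Fs. is_gieseker_HN_filtration X L B Fs \<longrightarrow>
             \<not> corresponds_to_parabolic_reduction X B E Fs))"
proof -
  interpret module_sheaf X V using V by (rule module_sheaf.intro)
  have "\<not> corresponds_to_parabolic_reduction X B E (claimed_filtration X V p)"
  proof
    assume "corresponds_to_parabolic_reduction X B E (claimed_filtration X V p)"
    then obtain lam U R where lam: "one_param_subgroup lam" and big: "big_open X U"
      and red: "reduction X B E U (parabolic lam) R"
      and Fs: "claimed_filtration X V p =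
        map (\<lambda>\<gamma>. saturated_extension X B U (associated_sub X B R (weight_flag lam \<gamma>)))
          (sorted_list_of_set (weights lam))" (is "_ = map ?F _")
      unfolding corresponds_to_parabolic_reduction_def by blast
    \<comment> \<open>Equality of the two filtrations as lists fixes the number of weights.\<close>
    have "length (sorted_list_of_set (weights lam)) = 3"
      using arg_cong[OF Fs, of length] by (simp add: claimed_filtration_def)
    moreover have "\<exists>a b c. xs = [a, b, c]" if "length xs = 3" for xs :: "int list"
      using that by (auto simp: numeral_3_eq_3 length_Suc_conv)
    ultimately obtain a b c where abc: "sorted_list_of_set (weights lam) = [a, b, c]"
      by metis
    have U: "U \<in> Op X X"
      using big openin_subset[of "zariski X" U] by (simp add: big_open_def Op_def)
    have "irreducible_closed (zariski X) X"
      using K3 unfolding K3_surface_def smooth_surface_def by (elim conjE)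
    then obtain x where x: "x \<in> U"
      using big_open_nonempty[OF _ big] by blast
    have p: "p \<in> sheaf_homs X V (structure_sheaf X) X"
      using extension by (simp only: short_exact_def)
    have surj: "\<exists>W\<in>Op X U. x \<in> W \<and> restrict b W \<in> p W ` Sec V W" if "b \<in> \<O> X U" for b
      using extension[unfolded short_exact_def, THEN conjunct2, THEN conjunct2, THEN bspec, OF U,
          THEN conjunct2, THEN conjunct2, THEN bspec, of b, THEN bspec, OF _ x] that
      by (simp only: structure_sheaf_simps)
    obtain W s t where W: "W \<in> Op X U" "x \<in> W"
      and st: "s \<in> (claimed_filtration X V p ! 0) W" "t \<in> (claimed_filtration X V p ! 1) W"
        "s \<in> Sec (with_dual X V) W" "t \<in> Sec (with_dual X V) W"
      and nonzero: "duality_form W s t x \<noteq> 0"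
      by (rule claimed_filtration_not_orthogonal[OF p U x surj])
    have W_X: "W \<in> Op X X" using W(1) U by (rule Op_trans)
    \<comment> \<open>Inside \<open>U\<close> the extension across the complement changes nothing,
      so \<open>s\<close> and \<open>t\<close> are sections of the associated subbundles themselves,
      up to the trivial restriction from \<open>W\<close> to \<open>W\<close>.\<close>
    have "W \<inter> U = W" using Op_subset[OF W(1)] by blast
    then have assoc: "rest B W W s \<in> associated_sub X B R (weight_flag lam a) W"
      "rest B W W t \<in> associated_sub X B R (weight_flag lam b) W"
      using st(1,2)[unfolded Fs abc] W_X by (simp_all add: saturated_extension_def)
    have "duality_form W (rest B W W s) (rest B W W t) x = 0"
      using reduction_sections_orthogonal[OF red[unfolded E B]
          parabolic_flags_orthogonal[OF lam _ abc] U W assoc[unfolded B]]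
      by (simp add: B)
    with nonzero show False
      using duality_form_rest[OF W_X Op_refl[OF W_X] W(2) st(3,4)] by (simp add: B)
  qed
  \<comment> \<open>The premise of the second conjunct identifies every Harder-Narasimhan filtration
    with the claimed one, so that conjunct follows by substitution.\<close>
  then show ?thesis by metis
qed

end
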